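(* Let $E$ be a rank-2 filtrable vector bundle on a Hopf surface $X$, and let $$0\to L_1\xrightarrow{\iota}E\xrightarrow{p}L_2\otimes I_Z\to0$$ be a Serre exact sequence for $E$ with $L_1,L_2\in\mathrm{Pic}(X)$ and $Z$ a zero-dimensional subspace. If the support of $Z$ is not contained in a divisor of $X$, then for any $H\in[\mathrm{Div}(X)]$, $$H^0(X,\mathcal{E}nd_0(E)\otimes H)\simeq H^0(X,L_1\otimes L_2^{-1}\otimes H).$$ In particular, any section $\phi\in H^0(X,\mathcal{E}nd_0(E)\otimes H)$ is nilpotent.
   Context: A (primary) Hopf surface is a compact complex surface homeomorphic to $S^1\times S^3$; it is a quotient of $\mathbb{C}^2\setminus\{0\}$ by the group generated by $(x,y)\mapsto(ax+\mu y^r,by)$ with $0<|a|\le|b|<1$, $r\in\mathbb{Z}_{>0}$, $(a-b^r)\mu=0$. A rank-2 bundle is filtrable if it admits a nonzero map from a line bundle. $I_Z$ is the ideal sheaf of $Z\subset X$. $\mathcal{E}nd_0(E)$ is the bundle of trace-free endomorphisms of $E$. $[\mathrm{Div}(X)]$ is the subgroup of $\mathrm{Pic}(X)$ generated by line bundles with a nonzero section. *)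

theory Defs
  imports "HOL-Analysis.Analysis"
begin

section \<open>Hopf surfaces\<close>

text \<open>A complex space is given by its topology and its structure sheaf: \<open>hol X U\<close> is the set of
  functions that are holomorphic on the open set \<open>U\<close>. Functions are total; their values outside \<open>U\<close>
  are irrelevant.\<close>

record 'a cspace =
  top_of :: "'a topology"
  hol :: "'a set \<Rightarrow> ('a \<Rightarrow> complex) set"

abbreviation points :: "'a cspace \<Rightarrow> 'a set" where
  "points X \<equiv> topspace (top_of X)"

definition holomorphic2_on :: "(complex \<times> complex \<Rightarrow> complex) \<Rightarrow> (complex \<times> complex) set \<Rightarrow> bool" where
  "holomorphic2_on f S \<longleftrightarrow>
     (\<forall>q\<in>S. \<exists>A B. (f has_derivative (\<lambda>(u, v). A * u + B * v)) (at q within S))"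

definition hopf_map :: "complex \<Rightarrow> complex \<Rightarrow> complex \<Rightarrow> nat \<Rightarrow> complex \<times> complex \<Rightarrow> complex \<times> complex" where
  "hopf_map a b \<mu> r = (\<lambda>(x, y). (a * x + \<mu> * y ^ r, b * y))"

text \<open>\<open>X\<close> is the quotient of the punctured plane by the infinite cyclic group generated by the
  bijection \<open>hopf_map a b \<mu> r\<close>, with quotient map \<open>q\<close>. Two points are in the same orbit iff some
  nonnegative power of the generator maps one of them to the other. The structure sheaf is that of the quotient.\<close>

definition hopf_surface :: "'a cspace \<Rightarrow> bool" where
  "hopf_surface X \<longleftrightarrow>
     (\<exists>a b \<mu> r q. 0 < cmod a \<and> cmod a \<le> cmod b \<and> cmod b < 1 \<and> 0 < r \<and> (a - b ^ r) * \<mu> = 0 \<and>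
        quotient_map (top_of_set (- {0})) (top_of X) q \<and>
        (\<forall>z\<in>- {0}. \<forall>w\<in>- {0}. q z = q w \<longleftrightarrow>
           (\<exists>n. (hopf_map a b \<mu> r ^^ n) z = w \<or> (hopf_map a b \<mu> r ^^ n) w = z)) \<and>
        (\<forall>U. openin (top_of X) U \<longrightarrow>
           hol X U = {f. holomorphic2_on (f \<circ> q) {z \<in> - {0}. q z \<in> U}}))"

section \<open>Holomorphic vector bundles\<close>

text \<open>A vector bundle of rank \<open>CARD('n)\<close> is a family of vector spaces with holomorphically compatible
  local trivialisations. Choosing a basis of each single fibre (without any compatibility between
  different fibres), the fibre over every point \<open>z\<close> is \<open>complex^'n\<close>. For each point \<open>x\<close>, \<open>chart E x\<close>
  is a neighbourhood of \<open>x\<close> over which \<open>E\<close> is trivialised, and for \<open>z\<close> in it the matrix \<open>triv E x z\<close>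
  is the isomorphism from the fibre over \<open>z\<close> to the model fibre \<open>complex^'n\<close>. As a function of \<open>z\<close> it
  need not even be continuous; only the transition functions are holomorphic.\<close>

record ('a, 'n) vbundle =
  chart :: "'a \<Rightarrow> 'a set"
  triv :: "'a \<Rightarrow> 'a \<Rightarrow> complex^'n^'n"

definition vector_bundle :: "'a cspace \<Rightarrow> ('a, 'n::finite) vbundle \<Rightarrow> bool" where
  "vector_bundle X E \<longleftrightarrow>
     (\<forall>x\<in>points X. openin (top_of X) (chart E x) \<and> x \<in> chart E x \<and>
        (\<forall>z\<in>chart E x. invertible (triv E x z))) \<and>
     (\<forall>x\<in>points X. \<forall>y\<in>points X. \<forall>i j.
        (\<lambda>z. (triv E x z ** matrix_inv (triv E y z)) $ i $ j) \<in> hol X (chart E x \<inter> chart E y))"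

abbreviation line_bundle :: "'a cspace \<Rightarrow> ('a, 1) vbundle \<Rightarrow> bool" where
  "line_bundle X L \<equiv> vector_bundle X L"

text \<open>Sections over \<open>U\<close> are extended by zero, so that distinct functions are distinct sections.\<close>

definition sections :: "'a cspace \<Rightarrow> ('a, 'n::finite) vbundle \<Rightarrow> 'a set \<Rightarrow> ('a \<Rightarrow> complex^'n) set" where
  "sections X E U = {s. (\<forall>z. z \<notin> U \<longrightarrow> s z = 0) \<and>
     (\<forall>x\<in>points X. \<forall>i. (\<lambda>z. (triv E x z *v s z) $ i) \<in> hol X (U \<inter> chart E x))}"

definition H0 :: "'a cspace \<Rightarrow> ('a, 'n::finite) vbundle \<Rightarrow> ('a \<Rightarrow> complex^'n) set" where
  "H0 X E = sections X E (points X)"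

definition bundle_hom :: "'a cspace \<Rightarrow> ('a, 'n::finite) vbundle \<Rightarrow> ('a, 'm::finite) vbundle \<Rightarrow>
    ('a \<Rightarrow> complex^'n^'m) \<Rightarrow> bool" where
  "bundle_hom X E F \<phi> \<longleftrightarrow>
     (\<forall>x\<in>points X. \<forall>y\<in>points X. \<forall>i j.
        (\<lambda>z. (triv F x z ** \<phi> z ** matrix_inv (triv E y z)) $ i $ j) \<in> hol X (chart F x \<inter> chart E y))"

definition bundle_iso :: "'a cspace \<Rightarrow> ('a, 'n::finite) vbundle \<Rightarrow> ('a, 'm::finite) vbundle \<Rightarrow> bool" where
  "bundle_iso X E F \<longleftrightarrow>
     (\<exists>\<phi> \<psi>. bundle_hom X E F \<phi> \<and> bundle_hom X F E \<psi> \<and>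
        (\<forall>z\<in>points X. \<phi> z ** \<psi> z = mat 1 \<and> \<psi> z ** \<phi> z = mat 1))"

definition tensor :: "('a, 'n::finite) vbundle \<Rightarrow> ('a, 'm::finite) vbundle \<Rightarrow> ('a, 'n \<times> 'm) vbundle" where
  "tensor E F = \<lparr>chart = (\<lambda>x. chart E x \<inter> chart F x),
     triv = (\<lambda>x z. \<chi> k l. triv E x z $ fst k $ fst l * triv F x z $ snd k $ snd l)\<rparr>"

definition dual :: "('a, 'n::finite) vbundle \<Rightarrow> ('a, 'n) vbundle" where
  "dual E = \<lparr>chart = chart E, triv = (\<lambda>x z. transpose (matrix_inv (triv E x z)))\<rparr>"

definition filtrable :: "'a cspace \<Rightarrow> ('a, 'n::finite) vbundle \<Rightarrow> bool" where
  "filtrable X E \<longleftrightarrow>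
     (\<exists>L \<phi>. line_bundle X L \<and> bundle_hom X L E \<phi> \<and> (\<exists>z\<in>points X. \<phi> z \<noteq> 0))"

text \<open>The index of \<open>tensor (tensor E (dual E)) H\<close> is \<open>((i, j), 1)\<close>. In these coordinates the
  trivialisation of \<open>E \<otimes> E\<^sup>* = \<E>nd(E)\<close> is \<open>A \<mapsto> T A T\<^sup>-\<^sup>1\<close>, where \<open>T\<close> is the trivialisation of \<open>E\<close>, and
  \<open>twisted_endo v\<close> is the endomorphism with values in the fibre \<open>complex\<close> of \<open>H\<close>.\<close>

definition twisted_endo :: "complex^(('n::finite \<times> 'n) \<times> 1) \<Rightarrow> complex^'n^'n" where
  "twisted_endo v = (\<chi> i j. v $ ((i, j), 1))"

definition H0_End0 :: "'a cspace \<Rightarrow> ('a, 'n::finite) vbundle \<Rightarrow> ('a, 1) vbundle \<Rightarrow>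
    ('a \<Rightarrow> complex^(('n \<times> 'n) \<times> 1)) set" where
  "H0_End0 X E H =
     {\<phi> \<in> H0 X (tensor (tensor E (dual E)) H). \<forall>z\<in>points X. trace (twisted_endo (\<phi> z)) = 0}"

text \<open>The \<open>n\<close>-th power of \<open>\<phi>\<close> is a section of \<open>\<E>nd(E) \<otimes> H\<^sup>n\<close>; as all fibres of \<open>H\<close> are \<open>complex\<close>,
  it is fibrewise the matrix power.\<close>

definition nilpotent_section :: "'a cspace \<Rightarrow> ('a \<Rightarrow> complex^(('n::finite \<times> 'n) \<times> 1)) \<Rightarrow> bool" where
  "nilpotent_section X \<phi> \<longleftrightarrow>
     (\<exists>n. \<forall>z\<in>points X. ((\<lambda>B. twisted_endo (\<phi> z) ** B) ^^ n) (mat 1) = 0)"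

definition linear_isomorphic :: "('a \<Rightarrow> complex^'n) set \<Rightarrow> ('a \<Rightarrow> complex^'m) set \<Rightarrow> bool" where
  "linear_isomorphic V W \<longleftrightarrow>
     (\<exists>T. bij_betw T V W \<and>
        (\<forall>s\<in>V. \<forall>t\<in>V. T (\<lambda>z. s z + t z) = (\<lambda>z. T s z + T t z)) \<and>
        (\<forall>c. \<forall>s\<in>V. T (\<lambda>z. c *s s z) = (\<lambda>z. c *s T s z)))"

section \<open>Divisors\<close>

text \<open>Line bundles whose class lies in the subgroup of \<open>Pic(X)\<close> generated by the classes of line bundles
  with a nonzero section. The neutral element, the trivial bundle, is one of the generators.\<close>

inductive Div_group :: "'a cspace \<Rightarrow> ('a, 1) vbundle \<Rightarrow> bool" for X where
  generator: "line_bundle X L \<Longrightarrow> s \<in> H0 X L \<Longrightarrow> s \<noteq> (\<lambda>_. 0) \<Longrightarrow> Div_group X L"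
| product: "Div_group X L \<Longrightarrow> Div_group X M \<Longrightarrow> line_bundle X N \<Longrightarrow> bundle_iso X N (tensor L M) \<Longrightarrow>
    Div_group X N"
| inverse: "Div_group X L \<Longrightarrow> line_bundle X N \<Longrightarrow> bundle_iso X N (dual L) \<Longrightarrow> Div_group X N"

text \<open>Effective (Cartier) divisors: \<open>f x\<close> is a local equation on the neighbourhood \<open>V x\<close> of \<open>x\<close>. Since
  only supports matter below, and the support of a divisor with positive and negative part is the support
  of an effective one, effective divisors suffice.\<close>

definition effective_divisor :: "'a cspace \<Rightarrow> ('a \<Rightarrow> 'a set) \<Rightarrow> ('a \<Rightarrow> 'a \<Rightarrow> complex) \<Rightarrow> bool" where
  "effective_divisor X V f \<longleftrightarrow>
     (\<forall>x\<in>points X. openin (top_of X) (V x) \<and> x \<in> V x \<and> f x \<in> hol X (V x) \<and>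
        (\<forall>W. openin (top_of X) W \<and> W \<noteq> {} \<and> W \<subseteq> V x \<longrightarrow> (\<exists>z\<in>W. f x z \<noteq> 0))) \<and>
     (\<forall>x\<in>points X. \<forall>y\<in>points X. \<exists>u\<in>hol X (V x \<inter> V y).
        \<forall>z\<in>V x \<inter> V y. u z \<noteq> 0 \<and> f x z = u z * f y z)"

definition divisor_support :: "'a cspace \<Rightarrow> ('a \<Rightarrow> 'a \<Rightarrow> complex) \<Rightarrow> 'a set" where
  "divisor_support X f = {x \<in> points X. f x x = 0}"

definition contained_in_divisor :: "'a cspace \<Rightarrow> 'a set \<Rightarrow> bool" where
  "contained_in_divisor X S \<longleftrightarrow> (\<exists>V f. effective_divisor X V f \<and> S \<subseteq> divisor_support X f)"

section \<open>Zero-dimensional subspaces and Serre exact sequences\<close>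

text \<open>A closed analytic subspace \<open>Z\<close> is given by its ideal sheaf \<open>I\<close>, a subsheaf of ideals of finite type of
  the structure sheaf (which is then coherent by Oka's theorem).\<close>

definition ideal_sheaf :: "'a cspace \<Rightarrow> ('a set \<Rightarrow> ('a \<Rightarrow> complex) set) \<Rightarrow> bool" where
  "ideal_sheaf X I \<longleftrightarrow>
     (\<forall>U. openin (top_of X) U \<longrightarrow>
        I U \<subseteq> hol X U \<and> (\<lambda>_. 0) \<in> I U \<and>
        (\<forall>f\<in>I U. \<forall>g\<in>I U. (\<lambda>z. f z + g z) \<in> I U) \<and>
        (\<forall>h\<in>hol X U. \<forall>f\<in>I U. (\<lambda>z. h z * f z) \<in> I U) \<and>
        (\<forall>f\<in>I U. \<forall>g. (\<forall>z\<in>U. g z = f z) \<longrightarrow> g \<in> I U) \<and>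
        (\<forall>V. openin (top_of X) V \<and> V \<subseteq> U \<longrightarrow> I U \<subseteq> I V) \<and>
        (\<forall>f. (\<forall>x\<in>U. \<exists>V. openin (top_of X) V \<and> x \<in> V \<and> V \<subseteq> U \<and> f \<in> I V) \<longrightarrow> f \<in> I U))"

definition finite_type_ideal :: "'a cspace \<Rightarrow> ('a set \<Rightarrow> ('a \<Rightarrow> complex) set) \<Rightarrow> bool" where
  "finite_type_ideal X I \<longleftrightarrow>
     (\<forall>x\<in>points X. \<exists>U G. openin (top_of X) U \<and> x \<in> U \<and> finite G \<and> G \<subseteq> I U \<and>
        (\<forall>V f. openin (top_of X) V \<and> V \<subseteq> U \<and> f \<in> I V \<longrightarrow>
           (\<forall>y\<in>V. \<exists>W c. openin (top_of X) W \<and> y \<in> W \<and> W \<subseteq> V \<and> (\<forall>g\<in>G. c g \<in> hol X W) \<and>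
              (\<forall>z\<in>W. f z = (\<Sum>g\<in>G. c g z * g z)))))"

text \<open>The support of the quotient of the structure sheaf by \<open>I\<close>: the points at which the stalk of \<open>I\<close>
  does not contain 1.\<close>

definition subspace_support :: "'a cspace \<Rightarrow> ('a set \<Rightarrow> ('a \<Rightarrow> complex) set) \<Rightarrow> 'a set" where
  "subspace_support X I =
     {x \<in> points X. \<not> (\<exists>U. openin (top_of X) U \<and> x \<in> U \<and> (\<lambda>_. 1) \<in> I U)}"

definition zero_dimensional_subspace :: "'a cspace \<Rightarrow> ('a set \<Rightarrow> ('a \<Rightarrow> complex) set) \<Rightarrow> bool" where
  "zero_dimensional_subspace X I \<longleftrightarrow> ideal_sheaf X I \<and> finite_type_ideal X I \<and>
     (\<forall>x\<in>subspace_support X I. \<exists>U. openin (top_of X) U \<and> U \<inter> subspace_support X I = {x})"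

text \<open>As \<open>F\<close> is locally free, \<open>F \<otimes> I\<close> is the subsheaf of \<open>F\<close> of sections with coordinates in \<open>I\<close>.\<close>

definition ideal_sections :: "'a cspace \<Rightarrow> ('a, 'n::finite) vbundle \<Rightarrow>
    ('a set \<Rightarrow> ('a \<Rightarrow> complex) set) \<Rightarrow> 'a set \<Rightarrow> ('a \<Rightarrow> complex^'n) set" where
  "ideal_sections X F I U = {s \<in> sections X F U.
     \<forall>x\<in>points X. \<forall>i. (\<lambda>z. (triv F x z *v s z) $ i) \<in> I (U \<inter> chart F x)}"

text \<open>Exactness, as a sequence of sheaves, of \<open>0 \<rightarrow> L1 \<rightarrow> E \<rightarrow> L2 \<otimes> I \<rightarrow> 0\<close>. The morphism from \<open>E\<close> to
  \<open>L2 \<otimes> I\<close> is a morphism to \<open>L2\<close> that takes values in the subsheaf. Image and surjectivity are local.\<close>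

definition serre_sequence :: "'a cspace \<Rightarrow> ('a, 1) vbundle \<Rightarrow> ('a \<Rightarrow> complex^1^2) \<Rightarrow> ('a, 2) vbundle \<Rightarrow>
    ('a \<Rightarrow> complex^2^1) \<Rightarrow> ('a, 1) vbundle \<Rightarrow> ('a set \<Rightarrow> ('a \<Rightarrow> complex) set) \<Rightarrow> bool" where
  "serre_sequence X L1 \<iota> E p L2 I \<longleftrightarrow>
     bundle_hom X L1 E \<iota> \<and> bundle_hom X E L2 p \<and>
     (\<forall>U. openin (top_of X) U \<longrightarrow>
        (\<forall>s\<in>sections X E U. (\<lambda>z. p z *v s z) \<in> ideal_sections X L2 I U) \<and>
        (\<forall>t\<in>sections X L1 U. (\<forall>z\<in>U. \<iota> z *v t z = 0) \<longrightarrow> (\<forall>z\<in>U. t z = 0)) \<and>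
        (\<forall>s\<in>sections X E U. (\<forall>z\<in>U. p z *v s z = 0) \<longleftrightarrow>
           (\<forall>x\<in>U. \<exists>V. openin (top_of X) V \<and> x \<in> V \<and> V \<subseteq> U \<and>
              (\<exists>t\<in>sections X L1 V. \<forall>z\<in>V. s z = \<iota> z *v t z))) \<and>
        (\<forall>s\<in>ideal_sections X L2 I U. \<forall>x\<in>U. \<exists>V. openin (top_of X) V \<and> x \<in> V \<and> V \<subseteq> U \<and>
           (\<exists>t\<in>sections X E V. \<forall>z\<in>V. p z *v t z = s z)))"

end

(* The map \<iota> embeds L1 in E, and p \<circ> \<phi> \<circ> \<iota> is a section of a line bundle that vanishes on Z because p does.
   As Z lies in no divisor, p \<circ> \<phi> \<circ> \<iota> = 0, so \<iota>(L1) is an eigenline of \<phi>: by exactness, \<phi> \<circ> \<iota> = \<tau> \<iota> with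
   \<tau> holomorphic, also at the points of Z, and \<tau>^2 = - det \<phi> as \<phi> is trace-free. If \<tau> did not vanish at a
   point of Z, some row of \<phi> - \<tau> would be nonzero there; both this row and p annihilate \<iota>, so p would be a
   holomorphic multiple of it, and the factor would have an isolated zero, which Hartogs' theorem excludes.
   Hence det \<phi>, a section of a line bundle, vanishes on Z, and therefore everywhere. So \<phi> is nilpotent and,
   away from Z, has the form \<iota> \<circ> \<psi> \<circ> p with a unique \<psi>, which extends over Z by Hartogs' theorem. *)

theory Submission
  imports Defs "HOL-Complex_Analysis.Conformal_Mappings"
begin

section \<open>Holomorphic functions of two variables\<close>

text \<open>The fibres of the bundles carry unrelated bases, so \<open>\<iota>\<close>,
  \<open>p\<close> and \<open>\<phi>\<close> need not even be continuous as matrix functions.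
  Holomorphy becomes visible only after multiplication by trivialisations, on neighbourhoods over
  which all four bundles are trivialised. That the support of \<open>Z\<close> lies in no divisor is
  used in one form: a scalar that becomes holomorphic after multiplication by local frames, and that
  vanishes on the support, vanishes everywhere. Since a local equation of a divisor may not vanish
  on an open set, this rests on the identity theorem, hence on the connectedness of the punctured
  plane. The obstacle is the points of \<open>Z\<close>: \<open>p\<close> vanishes there, so nothing
  can be divided by it. A statement at such a point comes either from a punctured neighbourhood,
  because points of \<open>X\<close> are not open, or from Hartogs' theorem. The latter is a
  statement about the plane and descends to the quotient because orbits are discrete. The
  isomorphism is constructed from the side of \<open>L1\<close>, \<open>L2\<close> and
  \<open>H\<close>, where it is given by a formula, and is then inverted.\<close>

lemma holomorphic2_on_cong:
  assumes "\<And>z. z \<in> S \<Longrightarrow> f z = g z" "holomorphic2_on f S"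
  shows "holomorphic2_on g S"
  unfolding holomorphic2_on_def
proof
  fix z assume z: "z \<in> S"
  then obtain A B where "(f has_derivative (\<lambda>(u, v). A * u + B * v)) (at z within S)"
    using assms(2) unfolding holomorphic2_on_def by blast
  then have "(g has_derivative (\<lambda>(u, v). A * u + B * v)) (at z within S)"
    by (rule has_derivative_transform[OF z, rotated]) (simp add: assms(1))
  then show "\<exists>A B. (g has_derivative (\<lambda>(u, v). A * u + B * v)) (at z within S)" by blast
qed

lemma holomorphic2_on_subset: "holomorphic2_on f S \<Longrightarrow> T \<subseteq> S \<Longrightarrow> holomorphic2_on f T"
  unfolding holomorphic2_on_def by (meson has_derivative_subset subsetD)

lemma holomorphic2_on_continuous: "holomorphic2_on f S \<Longrightarrow> continuous_on S f"
  unfolding holomorphic2_on_def continuous_on_eq_continuous_within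
  by (meson has_derivative_continuous)

lemma holomorphic2_on_open_local:
  assumes "\<And>z. z \<in> S \<Longrightarrow> \<exists>T. open T \<and> z \<in> T \<and> holomorphic2_on f (T \<inter> S)"
  shows "holomorphic2_on f S"
  unfolding holomorphic2_on_def
proof
  fix z assume z: "z \<in> S"
  then obtain T where T: "open T" "z \<in> T" "holomorphic2_on f (T \<inter> S)" using assms by blast
  then obtain A B where "(f has_derivative (\<lambda>(u, v). A * u + B * v)) (at z within (T \<inter> S))"
    using z unfolding holomorphic2_on_def by blast
  moreover have "at z within (T \<inter> S) = at z within S"
    by (rule at_within_nhd[OF T(2,1)]) auto
  ultimately show "\<exists>A B. (f has_derivative (\<lambda>(u, v). A * u + B * v)) (at z within S)" by auto
qed

lemma holomorphic2_on_const: "holomorphic2_on (\<lambda>_. c) S"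
  unfolding holomorphic2_on_def
proof
  fix z
  have "((\<lambda>_. c) has_derivative (\<lambda>(u, v). 0 * u + 0 * v)) (at z within S)"
    by (rule has_derivative_eq_rhs[OF has_derivative_const]) (auto simp: fun_eq_iff)
  then show "\<exists>A B. ((\<lambda>_. c) has_derivative (\<lambda>(u, v). A * u + B * v)) (at z within S)" by blast
qed

lemma holomorphic2_on_add:
  assumes "holomorphic2_on f S" "holomorphic2_on g S"
  shows "holomorphic2_on (\<lambda>z. f z + g z) S"
  unfolding holomorphic2_on_def
proof
  fix z assume z: "z \<in> S"
  obtain A B where f: "(f has_derivative (\<lambda>(u, v). A * u + B * v)) (at z within S)"
    using assms(1) z unfolding holomorphic2_on_def by blast
  obtain C D where g: "(g has_derivative (\<lambda>(u, v). C * u + D * v)) (at z within S)"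
    using assms(2) z unfolding holomorphic2_on_def by blast
  have "((\<lambda>z. f z + g z) has_derivative (\<lambda>(u, v). (A + C) * u + (B + D) * v)) (at z within S)"
    by (rule has_derivative_eq_rhs[OF has_derivative_add[OF f g]])
      (auto simp: fun_eq_iff algebra_simps)
  then show "\<exists>A B. ((\<lambda>z. f z + g z) has_derivative (\<lambda>(u, v). A * u + B * v)) (at z within S)" by blast
qed

lemma holomorphic2_on_mult:
  assumes "holomorphic2_on f S" "holomorphic2_on g S"
  shows "holomorphic2_on (\<lambda>z. f z * g z) S"
  unfolding holomorphic2_on_def
proof
  fix z assume z: "z \<in> S"
  obtain A B where f: "(f has_derivative (\<lambda>(u, v). A * u + B * v)) (at z within S)"
    using assms(1) z unfolding holomorphic2_on_def by blast
  obtain C D where g: "(g has_derivative (\<lambda>(u, v). C * u + D * v)) (at z within S)"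
    using assms(2) z unfolding holomorphic2_on_def by blast
  have "((\<lambda>z. f z * g z) has_derivative (\<lambda>(u, v). (f z * C + A * g z) * u + (f z * D + B * g z) * v))
      (at z within S)"
    by (rule has_derivative_eq_rhs[OF has_derivative_mult[OF f g]])
      (auto simp: fun_eq_iff algebra_simps)
  then show "\<exists>A B. ((\<lambda>z. f z * g z) has_derivative (\<lambda>(u, v). A * u + B * v)) (at z within S)" by blast
qed

lemma holomorphic2_on_inverse:
  assumes "holomorphic2_on f S" "\<And>z. z \<in> S \<Longrightarrow> f z \<noteq> 0"
  shows "holomorphic2_on (\<lambda>z. inverse (f z)) S"
  unfolding holomorphic2_on_def
proof
  fix z assume z: "z \<in> S"
  obtain A B where f: "(f has_derivative (\<lambda>(u, v). A * u + B * v)) (at z within S)"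
    using assms(1) z unfolding holomorphic2_on_def by blast
  have "((\<lambda>z. inverse (f z)) has_derivative
      (\<lambda>(u, v). (- inverse (f z) * A * inverse (f z)) * u + (- inverse (f z) * B * inverse (f z)) * v))
      (at z within S)"
    by (rule has_derivative_eq_rhs[OF Deriv.has_derivative_inverse[OF assms(2)[OF z] f]])
      (auto simp: fun_eq_iff algebra_simps)
  then show "\<exists>A B. ((\<lambda>z. inverse (f z)) has_derivative (\<lambda>(u, v). A * u + B * v)) (at z within S)"
    by blast
qed

section \<open>Reduction to one variable and the identity theorem\<close>

text \<open>By the chain rule the derivative of the composite is multiplication by
  \<open>A * c + B * d\<close>, which is complex linear. This opens the way to one-variable
  theorems.\<close>

lemma holomorphic2_on_complex_line:
  assumes f: "holomorphic2_on f S" and line: "\<And>t. t \<in> T \<Longrightarrow> (x + t * c, y + t * d) \<in> S"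
  shows "(\<lambda>t. f (x + t * c, y + t * d)) holomorphic_on T"
  unfolding holomorphic_on_def
proof
  fix t assume t: "t \<in> T"
  obtain A B where AB: "(f has_derivative (\<lambda>(u, v). A * u + B * v))
      (at (x + t * c, y + t * d) within S)"
    using f line[OF t] unfolding holomorphic2_on_def by blast
  have L: "((\<lambda>t. (x + t * c, y + t * d)) has_derivative (\<lambda>h. (h * c, h * d))) (at t within T)"
    by (auto intro!: derivative_eq_intros)
  have "((\<lambda>t. f (x + t * c, y + t * d)) has_derivative (\<lambda>h. case (h * c, h * d) of (u, v) \<Rightarrow> A * u + B * v))
      (at t within T)"
    by (rule has_derivative_in_compose[OF L has_derivative_subset[OF AB]]) (use line in auto)
  then have "((\<lambda>t. f (x + t * c, y + t * d)) has_derivative (*) (A * c + B * d)) (at t within T)"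
    by (rule has_derivative_eq_rhs) (auto simp: fun_eq_iff algebra_simps)
  then show "(\<lambda>t. f (x + t * c, y + t * d)) field_differentiable at t within T"
    unfolding field_differentiable_def has_field_derivative_def by blast
qed

text \<open>The complex line through \<open>w\<close> and \<open>v\<close> meets the convex set
  \<open>B\<close> in a convex, hence connected, set of parameters and meets \<open>W\<close> in a
  nonempty open one, so one-variable analytic continuation carries the zero from \<open>w\<close> to
  \<open>v\<close>.\<close>

lemma holomorphic2_identity_convex:
  assumes B: "open B" "convex B" and f: "holomorphic2_on f B"
    and W: "open W" "w \<in> W" "W \<subseteq> B" "\<And>z. z \<in> W \<Longrightarrow> f z = 0" and v: "v \<in> B"
  shows "f v = 0"
proof -
  define L where "L = (\<lambda>t::complex. (fst w + t * (fst v - fst w), snd w + t * (snd v - snd w)))"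
  have contL: "continuous_on UNIV L"
    unfolding L_def by (intro continuous_intros)
  have L0: "L 0 = w" and L1: "L 1 = v" by (auto simp: L_def)
  define T where "T = L -` B"
  have openT: "open T" unfolding T_def by (rule open_vimage[OF B(1) contL])
  have "convex T"
    unfolding T_def convex_def
  proof (intro ballI allI impI)
    fix s t :: complex and a b :: real
    assume st: "s \<in> L -` B" "t \<in> L -` B" and ab: "0 \<le> a" "0 \<le> b" "a + b = 1"
    have b: "b = 1 - a" using ab by simp
    have "a *\<^sub>R L s + b *\<^sub>R L t = L (a *\<^sub>R s + b *\<^sub>R t)"
      unfolding L_def b by (simp add: prod_eq_iff scaleR_conv_of_real algebra_simps)
    then show "a *\<^sub>R s + b *\<^sub>R t \<in> L -` B"
      using convexD[OF B(2) _ _ ab, of "L s" "L t"] st by simp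
  qed
  then have conn: "connected T" by (rule convex_connected)
  have hol: "(\<lambda>t. f (L t)) holomorphic_on T"
    unfolding L_def by (rule holomorphic2_on_complex_line[OF f]) (auto simp: T_def L_def)
  have openW: "open (L -` W)" by (rule open_vimage[OF W(1) contL])
  have "f (L 1) = 0"
  proof (rule analytic_continuation_open[OF openW openT _ conn _ hol, of "\<lambda>_. 0"])
    show "L -` W \<noteq> {}" using L0 W(2) by (metis empty_iff vimageI2)
    show "L -` W \<subseteq> T" using W(3) by (auto simp: T_def)
    show "1 \<in> T" using L1 v by (simp add: T_def)
  qed (use W(4) in auto)
  then show ?thesis by (simp add: L1)
qed

text \<open>Near \<open>z0 = (x0, y0)\<close> the extension is the Cauchy integral in the first variable over a circle around
  \<open>x0\<close>; its points \<open>(\<zeta>, y)\<close> avoid \<open>z0\<close> even for \<open>y = y0\<close>.\<close>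

lemma hartogs_point:
  fixes f :: "complex \<times> complex \<Rightarrow> complex"
  assumes S: "open S" "z0 \<in> S" and f: "holomorphic2_on f (S - {z0})"
  obtains c where "holomorphic2_on (f(z0 := c)) S"
proof -
  obtain x0 y0 where z0: "z0 = (x0, y0)" by (cases z0)
  obtain e where e: "e > 0" "ball z0 e \<subseteq> S" using S openE by blast
  \<comment> \<open>Any radius with \<open>2 * \<rho> < e\<close> would do: the distance in the
    product is at most the sum of the two coordinate distances, so the closed bidisc stays in the
    ball.\<close>
  define \<rho> where "\<rho> = e / 3"
  have \<rho>: "\<rho> > 0" using e by (simp add: \<rho>_def)
  have box: "(x, y) \<in> S" if "dist x0 x \<le> \<rho>" "dist y0 y \<le> \<rho>" for x y
  proof -
    have "dist z0 (x, y) \<le> dist x0 x + dist y0 y"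
      unfolding z0 dist_Pair_Pair by (rule sqrt_sum_squares_le_sum) auto
    also have "\<dots> < e" using that e by (simp add: \<rho>_def)
    finally show ?thesis using e by auto
  qed
  define D where "D = ball x0 \<rho> \<times> ball y0 \<rho>"
  have D: "open D" "z0 \<in> D" "D \<subseteq> S" using \<rho> box by (auto simp: D_def z0 open_Times)
  define \<gamma> where "\<gamma> = circlepath x0 \<rho>"
  define F where "F = (\<lambda>(x, y). integral {0..1} (\<lambda>t. f (\<gamma> t, y) / (\<gamma> t - x) * vector_derivative \<gamma> (at t)) / (2 * pi * \<i>))"
  \<comment> \<open>\<open>G\<close> is the difference quotient of \<open>F\<close> in the first
    variable, taken under the integral: \<open>1 / (\<gamma> t - x) - 1 / (\<gamma> t - x0)\<close>
    is \<open>(x - x0) / ((\<gamma> t - x) * (\<gamma> t - x0))\<close>. With it, differentiability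
    of \<open>F\<close> at \<open>z0\<close> needs only continuity of \<open>G\<close> and no
    differentiation under the integral sign.\<close>
  define G where "G = (\<lambda>(x, y). integral {0..1} (\<lambda>t. f (\<gamma> t, y) / ((\<gamma> t - x) * (\<gamma> t - x0)) * vector_derivative \<gamma> (at t)) / (2 * pi * \<i>))"
  have dist_\<gamma>: "dist x0 (\<gamma> t) = \<rho>" for t
    using \<rho> by (simp add: \<gamma>_def circlepath dist_norm norm_mult)
  have \<gamma>_ne: "\<gamma> t \<noteq> x" if "x \<in> ball x0 \<rho>" for t x
    using that dist_\<gamma>[of t] by auto
  have x0: "x0 \<in> ball x0 \<rho>" using \<rho> by simp
  have cont\<gamma>: "continuous_on UNIV \<gamma>"
    unfolding \<gamma>_def circlepath by (intro continuous_intros)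
  have d\<gamma>: "vector_derivative \<gamma> (at t) = 2 * pi * \<i> * \<rho> * exp (2 * of_real pi * \<i> * t)" for t
    unfolding \<gamma>_def by (rule vector_derivative_circlepath)
  have contd: "continuous_on UNIV (\<lambda>t. vector_derivative \<gamma> (at t))"
    unfolding d\<gamma> by (intro continuous_intros)
  have contf: "continuous_on (S - {z0}) f" by (rule holomorphic2_on_continuous[OF f])
  have contft: "continuous_on (D \<times> {0..1}) (\<lambda>(z, t). f (\<gamma> t, snd z))"
  proof -
    have 1: "continuous_on (D \<times> {0..1}) (\<lambda>w. (\<gamma> (snd w), snd (fst w)))"
      by (intro continuous_intros continuous_on_compose2[OF cont\<gamma>]) auto
    have 2: "(\<lambda>w. (\<gamma> (snd w), snd (fst w))) ` (D \<times> {0..1}) \<subseteq> S - {z0}"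
      using box dist_\<gamma> \<gamma>_ne[OF x0] by (fastforce simp: D_def z0)
    show ?thesis
      using continuous_on_compose2[OF contf 1 2] by (simp add: case_prod_unfold)
  qed
  have contK: "continuous_on (D \<times> {0..1}) (\<lambda>(z, t). f (\<gamma> t, snd z) / (\<gamma> t - fst z) * vector_derivative \<gamma> (at t))"
    using contft \<gamma>_ne unfolding case_prod_unfold
    by (intro continuous_intros continuous_on_compose2[OF cont\<gamma>] continuous_on_compose2[OF contd])
      (auto simp: D_def)
  have contK2: "continuous_on (D \<times> {0..1}) (\<lambda>(z, t). f (\<gamma> t, snd z) / ((\<gamma> t - fst z) * (\<gamma> t - x0)) * vector_derivative \<gamma> (at t))"
    using contft \<gamma>_ne x0 unfolding case_prod_unfold
    by (intro continuous_intros continuous_on_compose2[OF cont\<gamma>] continuous_on_compose2[OF contd])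
      (auto simp: D_def)
  have contF: "continuous_on D F"
  proof -
    have "continuous_on D (\<lambda>z. integral (cbox 0 1) (\<lambda>t. f (\<gamma> t, snd z) / (\<gamma> t - fst z) * vector_derivative \<gamma> (at t)))"
      by (rule integral_continuous_on_param) (use contK in simp)
    then show ?thesis
      unfolding F_def case_prod_unfold cbox_interval by (intro continuous_on_divide continuous_on_const) auto
  qed
  have contG: "continuous_on D G"
  proof -
    have "continuous_on D (\<lambda>z. integral (cbox 0 1) (\<lambda>t. f (\<gamma> t, snd z) / ((\<gamma> t - fst z) * (\<gamma> t - x0)) * vector_derivative \<gamma> (at t)))"
      by (rule integral_continuous_on_param) (use contK2 in simp)
    then show ?thesis
      unfolding G_def case_prod_unfold cbox_interval by (intro continuous_on_divide continuous_on_const) auto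
  qed
  have FG: "F (x, y) = F (x0, y) + (x - x0) * G (x, y)" if xy: "(x, y) \<in> D" for x y
  proof -
    have int1: "(\<lambda>t. f (\<gamma> t, y) / (\<gamma> t - x') * vector_derivative \<gamma> (at t)) integrable_on {0..1}"
      if "(x', y) \<in> D" for x'
    proof -
      have "continuous_on {0..1} (\<lambda>t. (\<lambda>(z, t). f (\<gamma> t, snd z) / (\<gamma> t - fst z) * vector_derivative \<gamma> (at t)) ((x', y), t))"
        by (rule continuous_on_compose2[OF contK]) (use that in \<open>auto intro!: continuous_intros\<close>)
      then show ?thesis by (auto intro: integrable_continuous_interval)
    qed
    have y: "(x0, y) \<in> D" using xy x0 by (auto simp: D_def)
    have "integral {0..1} (\<lambda>t. f (\<gamma> t, y) / (\<gamma> t - x) * vector_derivative \<gamma> (at t))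
        - integral {0..1} (\<lambda>t. f (\<gamma> t, y) / (\<gamma> t - x0) * vector_derivative \<gamma> (at t))
      = integral {0..1} (\<lambda>t. f (\<gamma> t, y) / (\<gamma> t - x) * vector_derivative \<gamma> (at t)
          - f (\<gamma> t, y) / (\<gamma> t - x0) * vector_derivative \<gamma> (at t))"
      by (rule integral_diff[symmetric]) (use int1 xy y in auto)
    also have "\<dots> = integral {0..1} (\<lambda>t. (x - x0) * (f (\<gamma> t, y) / ((\<gamma> t - x) * (\<gamma> t - x0)) * vector_derivative \<gamma> (at t)))"
    proof (rule integral_cong)
      fix t
      have "\<gamma> t - x \<noteq> 0" "\<gamma> t - x0 \<noteq> 0" using \<gamma>_ne x0 xy by (auto simp: D_def)
      then show "f (\<gamma> t, y) / (\<gamma> t - x) * vector_derivative \<gamma> (at t)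
          - f (\<gamma> t, y) / (\<gamma> t - x0) * vector_derivative \<gamma> (at t)
        = (x - x0) * (f (\<gamma> t, y) / ((\<gamma> t - x) * (\<gamma> t - x0)) * vector_derivative \<gamma> (at t))"
        by (simp add: divide_simps) (simp add: algebra_simps)
    qed
    also have "\<dots> = (x - x0) * integral {0..1} (\<lambda>t. f (\<gamma> t, y) / ((\<gamma> t - x) * (\<gamma> t - x0)) * vector_derivative \<gamma> (at t))"
      by (rule integral_mult_right)
    finally show ?thesis
      unfolding F_def G_def prod.case
      by (simp add: field_simps)
  qed
  have fx: "(\<lambda>x. f (x, y)) holomorphic_on cball x0 \<rho>" if "y \<noteq> y0" "y \<in> ball y0 \<rho>" for y
  proof -
    have "(\<lambda>t. f (0 + t * 1, y + t * 0)) holomorphic_on cball x0 \<rho>"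
      by (rule holomorphic2_on_complex_line[OF f]) (use that box in \<open>auto simp: z0\<close>)
    then show ?thesis by simp
  qed
  have Ff1: "F (x, y) = f (x, y)" if xy: "(x, y) \<in> D" "y \<noteq> y0" for x y
  proof -
    have "((\<lambda>u. f (u, y) / (u - x)) has_contour_integral (2 * of_real pi * \<i> * f (x, y))) (circlepath x0 \<rho>)"
      by (rule Cauchy_integral_circlepath_simple[OF fx]) (use xy in \<open>auto simp: D_def dist_norm norm_minus_commute\<close>)
    then have "contour_integral \<gamma> (\<lambda>u. f (u, y) / (u - x)) = 2 * of_real pi * \<i> * f (x, y)"
      unfolding \<gamma>_def by (rule contour_integral_unique)
    then show ?thesis unfolding F_def contour_integral_integral by simp
  qed
  \<comment> \<open>The slice \<open>y = y0\<close> contains the puncture, so Cauchy's formula does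
    not apply on it. There the equality is the limit of the equality on the neighbouring slices,
    both sides being continuous away from \<open>z0\<close>.\<close>
  have Ff: "F z = f z" if z: "z \<in> D" "z \<noteq> z0" for z
  proof (cases "snd z = y0")
    case False
    then show ?thesis using Ff1[of "fst z" "snd z"] z by simp
  next
    case True
    obtain x where zx: "z = (x, y0)" using True by (cases z) auto
    have "open (D - {z0})" using D by auto
    then have "continuous_on (D - {z0}) (\<lambda>w. F w - f w)"
      using contF contf D(3) by (intro continuous_intros) (auto elim: continuous_on_subset)
    then have C: "isCont (\<lambda>w. F w - f w) z"
      using \<open>open (D - {z0})\<close> z continuous_on_eq_continuous_at by blast
    have "isCont (\<lambda>y. (\<lambda>w. F w - f w) (x, y)) y0"
      by (rule isCont_o2[where g = "\<lambda>w. F w - f w" and f = "\<lambda>y. (x, y)"]) (use C zx in \<open>auto intro!: continuous_intros\<close>)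
    then have "((\<lambda>y. F (x, y) - f (x, y)) \<longlongrightarrow> F (x, y0) - f (x, y0)) (at y0)"
      by (simp add: isCont_def)
    moreover have "((\<lambda>y. F (x, y) - f (x, y)) \<longlongrightarrow> 0) (at y0)"
    proof (rule tendsto_eventually)
      have "\<forall>\<^sub>F y in at y0. y \<in> ball y0 \<rho> - {y0}"
        by (rule eventually_at_in_open) (use \<rho> in auto)
      then show "\<forall>\<^sub>F y in at y0. F (x, y) - f (x, y) = 0"
        by eventually_elim (use z zx Ff1 in \<open>auto simp: D_def\<close>)
    qed
    ultimately have "F (x, y0) - f (x, y0) = 0"
      using tendsto_unique trivial_limit_at by blast
    then show ?thesis using zx by simp
  qed
  \<comment> \<open>The derivative of \<open>F\<close> in the second variable at \<open>z0\<close>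
    comes from one-variable theory: \<open>F (x0, y)\<close> is continuous in \<open>y\<close> and
    equals the holomorphic \<open>f (x0, y)\<close> for \<open>y \<noteq> y0\<close>, so the
    singularity at \<open>y0\<close> is removable.\<close>
  have contFy: "continuous_on (ball y0 \<rho>) (\<lambda>y. F (x0, y))"
    by (rule continuous_on_compose2[OF contF]) (use x0 in \<open>auto simp: D_def intro!: continuous_intros\<close>)
  have "(\<lambda>t. f (x0 + t * 0, 0 + t * 1)) holomorphic_on (ball y0 \<rho> - {y0})"
    by (rule holomorphic2_on_complex_line[OF f]) (use \<rho> box in \<open>auto simp: z0\<close>)
  then have "(\<lambda>y. F (x0, y)) holomorphic_on (ball y0 \<rho> - {y0})"
    by (rule holomorphic_transform) (use x0 Ff1 in \<open>auto simp: D_def\<close>)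
  then have "(\<lambda>y. F (x0, y)) holomorphic_on ball y0 \<rho>"
    by (intro no_isolated_singularity[OF contFy _ open_ball, of "{y0}"]) auto
  then obtain B where B: "((\<lambda>y. F (x0, y)) has_field_derivative B) (at y0)"
    using \<rho> by (meson centre_in_ball holomorphic_on_imp_differentiable_at field_differentiable_def open_ball)
  \<comment> \<open>Continuity of \<open>G\<close> at \<open>z0\<close> suffices, because the other
    factor vanishes there.\<close>
  have Gd: "((\<lambda>w. (fst w - x0) * G w) has_derivative (\<lambda>(u, v). G z0 * u)) (at z0)"
    unfolding has_derivative_iff_norm
  proof (intro conjI)
    show "bounded_linear (\<lambda>(u, v). G z0 * u)"
      unfolding case_prod_unfold by (intro bounded_linear_mult_right[THEN bounded_linear_compose] bounded_linear_fst)
    have "isCont G z0" using contG D by (simp add: continuous_on_eq_continuous_at)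
    then have "((\<lambda>w. norm (G w - G z0)) \<longlongrightarrow> 0) (at z0)"
      by (simp add: isCont_def LIM_zero_iff tendsto_norm_zero_iff)
    then show "((\<lambda>w. norm ((fst w - x0) * G w - (fst z0 - x0) * G z0 - (case w - z0 of (u, v) \<Rightarrow> G z0 * u))
        / norm (w - z0)) \<longlongrightarrow> 0) (at z0)"
    proof (rule Lim_null_comparison[rotated], intro always_eventually allI)
      fix w :: "complex \<times> complex"
      have "(fst w - x0) * G w - (fst z0 - x0) * G z0 - (case w - z0 of (u, v) \<Rightarrow> G z0 * u)
          = fst (w - z0) * (G w - G z0)"
        by (cases w) (simp add: z0 algebra_simps)
      moreover have "norm (fst (w - z0)) \<le> norm (w - z0)" by (metis norm_fst_le prod.collapse)
      ultimately have "norm ((fst w - x0) * G w - (fst z0 - x0) * G z0 - (case w - z0 of (u, v) \<Rightarrow> G z0 * u))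
          \<le> norm (w - z0) * norm (G w - G z0)"
        by (simp add: norm_mult mult_right_mono)
      then show "norm (norm ((fst w - x0) * G w - (fst z0 - x0) * G z0 - (case w - z0 of (u, v) \<Rightarrow> G z0 * u))
        / norm (w - z0)) \<le> norm (G w - G z0)"
        by (cases "w = z0") (auto simp: divide_simps mult.commute)
    qed
  qed
  have "((\<lambda>w. F (x0, snd w)) has_derivative (\<lambda>w. B * snd w)) (at z0)"
    by (rule has_derivative_compose[of snd snd, where g = "\<lambda>y. F (x0, y)", simplified])
      (use B in \<open>auto simp: z0 has_field_derivative_def intro!: derivative_eq_intros\<close>)
  from has_derivative_add[OF this Gd]
  have "((\<lambda>w. F (x0, snd w) + (fst w - x0) * G w) has_derivative (\<lambda>(u, v). G z0 * u + B * v)) (at z0)"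
    by (rule has_derivative_eq_rhs) (auto simp: fun_eq_iff)
  then have Fd: "(F has_derivative (\<lambda>(u, v). G z0 * u + B * v)) (at z0)"
    by (rule has_derivative_transform_within_open[OF _ D(1,2)]) (use FG in \<open>auto simp: case_prod_unfold\<close>)
  have "holomorphic2_on (f(z0 := F z0)) S"
    unfolding holomorphic2_on_def
  proof
    fix z assume z: "z \<in> S"
    show "\<exists>A B. ((f(z0 := F z0)) has_derivative (\<lambda>(u, v). A * u + B * v)) (at z within S)"
    proof (cases "z = z0")
      case True
      have "((f(z0 := F z0)) has_derivative (\<lambda>(u, v). G z0 * u + B * v)) (at z0)"
        by (rule has_derivative_transform_within_open[OF Fd D(1,2)]) (simp add: Ff)
      then show ?thesis using True has_derivative_at_withinI by blast
    next
      case False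
      have op: "open (S - {z0})" using S by auto
      obtain A B where "(f has_derivative (\<lambda>(u, v). A * u + B * v)) (at z within (S - {z0}))"
        using f z False unfolding holomorphic2_on_def by blast
      then have "(f has_derivative (\<lambda>(u, v). A * u + B * v)) (at z)"
        using at_within_open[OF _ op] z False by auto
      then have "((f(z0 := F z0)) has_derivative (\<lambda>(u, v). A * u + B * v)) (at z)"
        by (rule has_derivative_transform_within_open[OF _ op]) (use z False in auto)
      then show ?thesis using has_derivative_at_withinI by blast
    qed
  qed
  then show thesis by (rule that)
qed

section \<open>Functions on a Hopf surface\<close>

locale hopf_quotient =
  fixes X :: "'a cspace" and a b \<mu> :: complex and r :: nat and q :: "complex \<times> complex \<Rightarrow> 'a"
  assumes a_pos: "0 < cmod a" and a_le_b: "cmod a \<le> cmod b" and b_less: "cmod b < 1" and r_pos: "0 < r"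
    and quot: "quotient_map (top_of_set (- {0})) (top_of X) q"
    and fibre: "\<And>z w. z \<noteq> 0 \<Longrightarrow> w \<noteq> 0 \<Longrightarrow> q z = q w \<longleftrightarrow>
      (\<exists>n. (hopf_map a b \<mu> r ^^ n) z = w \<or> (hopf_map a b \<mu> r ^^ n) w = z)"
    and hol_eq: "\<And>U. openin (top_of X) U \<Longrightarrow> hol X U = {f. holomorphic2_on (f \<circ> q) {z \<in> - {0}. q z \<in> U}}"
begin

section \<open>Open sets and holomorphic functions seen through the quotient map\<close>

abbreviation opn :: "'a set \<Rightarrow> bool" where "opn \<equiv> openin (top_of X)"

definition pre :: "'a set \<Rightarrow> (complex \<times> complex) set" where
  "pre U = {z \<in> - {0}. q z \<in> U}"

lemma a0: "a \<noteq> 0" and b0: "b \<noteq> 0"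
  using a_pos a_le_b by auto

lemma a_less: "cmod a < 1"
  using a_le_b b_less by simp

lemma opn_iff: "U \<subseteq> points X \<Longrightarrow> opn U \<longleftrightarrow> open (pre U)"
  using quot unfolding quotient_map_def pre_def
  by (simp add: openin_open_eq[of "- {0}"] Collect_subset open_Compl subset_iff)

lemma open_pre: "opn U \<Longrightarrow> open (pre U)"
  using opn_iff openin_subset by blast

lemma q_surj: "x \<in> points X \<Longrightarrow> \<exists>z. z \<noteq> 0 \<and> q z = x"
proof -
  assume "x \<in> points X"
  then have "x \<in> q ` (- {0})" using quot unfolding quotient_map_def by simp
  then show ?thesis by auto
qed

lemma q_points: "z \<noteq> 0 \<Longrightarrow> q z \<in> points X"
  using quot unfolding quotient_map_def by auto

lemma opn_points: "opn U \<Longrightarrow> x \<in> U \<Longrightarrow> x \<in> points X"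
  using openin_subset by blast

lemma hol_iff: "opn U \<Longrightarrow> f \<in> hol X U \<longleftrightarrow> holomorphic2_on (\<lambda>z. f (q z)) (pre U)"
  by (simp add: hol_eq pre_def comp_def)

lemma hol_cong: "opn U \<Longrightarrow> f \<in> hol X U \<Longrightarrow> (\<And>z. z \<in> U \<Longrightarrow> f z = g z) \<Longrightarrow> g \<in> hol X U"
  unfolding hol_iff by (erule holomorphic2_on_cong[rotated]) (simp add: pre_def)

lemma hol_subset: "opn U \<Longrightarrow> f \<in> hol X U \<Longrightarrow> opn V \<Longrightarrow> V \<subseteq> U \<Longrightarrow> f \<in> hol X V"
  unfolding hol_iff by (erule holomorphic2_on_subset) (auto simp: pre_def)

lemma hol_const: "opn U \<Longrightarrow> (\<lambda>_. c) \<in> hol X U"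
  unfolding hol_iff by (rule holomorphic2_on_const)

lemma hol_add: "opn U \<Longrightarrow> f \<in> hol X U \<Longrightarrow> g \<in> hol X U \<Longrightarrow> (\<lambda>z. f z + g z) \<in> hol X U"
  unfolding hol_iff by (rule holomorphic2_on_add)

lemma hol_mult: "opn U \<Longrightarrow> f \<in> hol X U \<Longrightarrow> g \<in> hol X U \<Longrightarrow> (\<lambda>z. f z * g z) \<in> hol X U"
  unfolding hol_iff by (rule holomorphic2_on_mult)

lemma hol_inverse: "opn U \<Longrightarrow> f \<in> hol X U \<Longrightarrow> (\<And>z. z \<in> U \<Longrightarrow> f z \<noteq> 0) \<Longrightarrow> (\<lambda>z. inverse (f z)) \<in> hol X U"
  unfolding hol_iff by (rule holomorphic2_on_inverse) (auto simp: pre_def)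

lemma hol_uminus: "opn U \<Longrightarrow> f \<in> hol X U \<Longrightarrow> (\<lambda>z. - f z) \<in> hol X U"
  using hol_mult[OF _ hol_const[of U "-1"], of f] by simp

lemma hol_diff: "opn U \<Longrightarrow> f \<in> hol X U \<Longrightarrow> g \<in> hol X U \<Longrightarrow> (\<lambda>z. f z - g z) \<in> hol X U"
  using hol_add[OF _ _ hol_uminus[of U g], of f] by simp

lemma hol_divide:
  "opn U \<Longrightarrow> f \<in> hol X U \<Longrightarrow> g \<in> hol X U \<Longrightarrow> (\<And>z. z \<in> U \<Longrightarrow> g z \<noteq> 0) \<Longrightarrow> (\<lambda>z. f z / g z) \<in> hol X U"
  using hol_mult[OF _ _ hol_inverse[of U g], of f] by (simp add: divide_inverse)

lemma hol_sum:
  "finite A \<Longrightarrow> opn U \<Longrightarrow> (\<And>i. i \<in> A \<Longrightarrow> f i \<in> hol X U) \<Longrightarrow> (\<lambda>z. \<Sum>i\<in>A. f i z) \<in> hol X U"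
  by (induction A rule: finite_induct) (auto simp: hol_const intro: hol_add)

lemma hol_local:
  assumes U: "opn U" and loc: "\<And>x. x \<in> U \<Longrightarrow> \<exists>V. opn V \<and> x \<in> V \<and> f \<in> hol X (U \<inter> V)"
  shows "f \<in> hol X U"
  unfolding hol_iff[OF U]
proof (rule holomorphic2_on_open_local)
  fix z assume "z \<in> pre U"
  then obtain V where V: "opn V" "q z \<in> V" "f \<in> hol X (U \<inter> V)" using loc by (auto simp: pre_def)
  have "z \<in> pre V" using \<open>z \<in> pre U\<close> V by (auto simp: pre_def)
  moreover have "pre V \<inter> pre U = pre (U \<inter> V)" by (auto simp: pre_def)
  ultimately show "\<exists>T. open T \<and> z \<in> T \<and> holomorphic2_on (\<lambda>z. f (q z)) (T \<inter> pre U)"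
    using V open_pre[OF V(1)] hol_iff[of "U \<inter> V"] U by (metis openin_Int)
qed

lemma opn_nonzero:
  assumes U: "opn U" and f: "f \<in> hol X U"
  shows "opn {z \<in> U. f z \<noteq> 0}"
proof -
  have "continuous_on (pre U) (\<lambda>z. f (q z))"
    using f holomorphic2_on_continuous unfolding hol_iff[OF U] by blast
  then have "open (pre U \<inter> (\<lambda>z. f (q z)) -` (- {0}))"
    by (rule continuous_open_preimage[OF _ open_pre[OF U]]) auto
  moreover have "pre {z \<in> U. f z \<noteq> 0} = pre U \<inter> (\<lambda>z. f (q z)) -` (- {0})"
    by (auto simp: pre_def)
  moreover have "{z \<in> U. f z \<noteq> 0} \<subseteq> points X"
    using openin_subset[OF U] by auto
  ultimately show ?thesis using opn_iff by simp
qed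

section \<open>Orbits of the generator\<close>

lemma snd_hopf_map_power: "snd ((hopf_map a b \<mu> r ^^ n) z) = b ^ n * snd z"
  by (induction n) (auto simp: hopf_map_def split: prod.split)

lemma hopf_map_power_axis: "(hopf_map a b \<mu> r ^^ n) (x, 0) = (a ^ n * x, 0)"
  using r_pos by (induction n) (auto simp: hopf_map_def)

lemma inj_hopf_map: "inj (hopf_map a b \<mu> r)"
  using a0 b0 by (auto simp: inj_def hopf_map_def)

lemma continuous_hopf_map_power: "continuous_on UNIV (hopf_map a b \<mu> r ^^ n)"
proof (induction n)
  case (Suc n)
  have "continuous_on UNIV (hopf_map a b \<mu> r)"
    unfolding hopf_map_def case_prod_unfold by (intro continuous_intros)
  then show ?case
    unfolding funpow.simps by (intro continuous_on_compose[OF Suc]) (rule continuous_on_subset, auto)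
qed (simp add: id_def)

lemma hopf_map_power_nonzero: "z \<noteq> 0 \<Longrightarrow> (hopf_map a b \<mu> r ^^ n) z \<noteq> 0"
  using injD[OF inj_fn[OF inj_hopf_map], of n z 0] hopf_map_power_axis[of n 0]
  by (auto simp: zero_prod_def)

text \<open>Off the axis \<open>y = 0\<close> the second coordinates of points in one orbit differ
  by powers of \<open>b\<close>; on the axis the first coordinates differ by powers of
  \<open>a\<close>. Both cases are instances of \<open>key\<close>, where a coordinate
  \<open>p\<close> is multiplied by powers of some \<open>c\<close> with
  \<open>0 < cmod c < 1\<close>, so that distinct orbit points have moduli in a geometric
  progression.\<close>

lemma fibre_discrete:
  assumes z: "z \<noteq> 0"
  obtains T where "open T" "z \<in> T" "\<And>w. w \<in> T \<Longrightarrow> w \<noteq> 0 \<Longrightarrow> w \<noteq> z \<Longrightarrow> q w \<noteq> q z"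
proof -
  have key: thesis
    if c: "0 < cmod c" "cmod c < 1" and p: "continuous_on UNIV p" "p z \<noteq> 0"
      and step: "\<And>w. w \<noteq> 0 \<Longrightarrow> q w = q z \<Longrightarrow> (\<exists>n. p w = c ^ n * p z \<and> (n = 0 \<longrightarrow> w = z) \<or>
        p z = c ^ n * p w \<and> (n = 0 \<longrightarrow> w = z))"
    for c :: complex and p :: "complex \<times> complex \<Rightarrow> complex"
  proof
    \<comment> \<open>An open annulus around the modulus of \<open>p z\<close>, bounded by the next
      moduli in the progression on either side; only exponent \<open>0\<close> fits into it.\<close>
    let ?T = "(\<lambda>w. cmod (p w)) -` {cmod c * cmod (p z) <..< cmod (p z) / cmod c}"
    show "open ?T"
      by (rule open_vimage) (auto intro!: continuous_intros p(1))
    show "z \<in> ?T"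
      using c p(2) by (auto simp: field_simps)
    fix w assume w: "w \<in> ?T" "w \<noteq> 0" and "w \<noteq> z"
    have "w = z" if "q w = q z"
    proof -
      have pow: "cmod c ^ n \<le> cmod c" if "n \<noteq> 0" for n
        using c that power_decreasing[of 1 n "cmod c"] by simp
      from step[OF w(2) that] obtain n where
        "p w = c ^ n * p z \<and> (n = 0 \<longrightarrow> w = z) \<or> p z = c ^ n * p w \<and> (n = 0 \<longrightarrow> w = z)" by blast
      then show ?thesis
      proof (elim disjE conjE)
        assume n: "p w = c ^ n * p z" "n = 0 \<longrightarrow> w = z"
        then have "n = 0"
          using w(1) mult_right_mono[OF pow, of n "cmod (p z)"] by (force simp: norm_mult norm_power)
        with n show ?thesis by simp
      next
        assume n: "p z = c ^ n * p w" "n = 0 \<longrightarrow> w = z"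
        have "cmod c * cmod (p w) < cmod (p z)"
          using w(1) c by (simp add: field_simps)
        then have "n = 0"
          using arg_cong[OF n(1), of cmod] mult_right_mono[OF pow, of n "cmod (p w)"]
          by (force simp: norm_mult norm_power)
        with n show ?thesis by simp
      qed
    qed
    then show "q w \<noteq> q z" using \<open>w \<noteq> z\<close> by blast
  qed
  show thesis
  proof (cases "snd z = 0")
    case False
    show thesis
    proof (rule key[of b snd])
      fix w assume "w \<noteq> 0" "q w = q z"
      then obtain n where n: "(hopf_map a b \<mu> r ^^ n) w = z \<or> (hopf_map a b \<mu> r ^^ n) z = w"
        using fibre z by blast
      show "\<exists>n. snd w = b ^ n * snd z \<and> (n = 0 \<longrightarrow> w = z) \<or> snd z = b ^ n * snd w \<and> (n = 0 \<longrightarrow> w = z)"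
        by (intro exI[of _ n]) (use n snd_hopf_map_power[of n w] snd_hopf_map_power[of n z] in \<open>cases "n = 0"; auto\<close>)
    qed (use b0 b_less False in \<open>auto intro!: continuous_intros\<close>)
  next
    case True
    then obtain x where zx: "z = (x, 0)" by (cases z) auto
    show thesis
    proof (rule key[of a fst])
      fix w assume "w \<noteq> 0" "q w = q z"
      then obtain n where n: "(hopf_map a b \<mu> r ^^ n) w = z \<or> (hopf_map a b \<mu> r ^^ n) z = w"
        using fibre z by blast
      \<comment> \<open>The axis is invariant in both directions; this matters because the first
        coordinate scales by \<open>a\<close> only on the axis.\<close>
      have "snd w = 0"
        using n snd_hopf_map_power[of n w] snd_hopf_map_power[of n z] b0 True by auto
      then obtain y where wy: "w = (y, 0)" by (cases w) auto
      show "\<exists>n. fst w = a ^ n * fst z \<and> (n = 0 \<longrightarrow> w = z) \<or> fst z = a ^ n * fst w \<and> (n = 0 \<longrightarrow> w = z)"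
        by (intro exI[of _ n]) (use n in \<open>auto simp: zx wy hopf_map_power_axis\<close>)
    qed (use a0 a_less z in \<open>auto simp: zx zero_prod_def intro!: continuous_intros\<close>)
  qed
qed

section \<open>Passing from a punctured neighbourhood to its centre\<close>

text \<open>As fibres are discrete, an open point of \<open>X\<close> would yield an open point of
  the plane.\<close>

lemma not_opn_singleton: "\<not> opn {x}"
proof
  assume op: "opn {x}"
  then obtain z where z: "z \<noteq> 0" "q z = x" using q_surj opn_points by blast
  then obtain T where T: "open T" "z \<in> T" "\<And>w. w \<in> T \<Longrightarrow> w \<noteq> 0 \<Longrightarrow> w \<noteq> z \<Longrightarrow> q w \<noteq> q z"
    using fibre_discrete by metis
  have "pre {x} \<inter> T = {z}" using T z by (auto simp: pre_def)
  then have "open {z}" using open_pre[OF op] T(1) by (metis open_Int)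
  then show False using not_open_singleton by blast
qed

text \<open>Otherwise the open set where \<open>f\<close> is nonzero would be the single point
  \<open>x\<close>. This is the means of carrying identities from a punctured neighbourhood to a
  point of the support of \<open>Z\<close>.\<close>

lemma hol_eq_zero_at:
  assumes U: "opn U" and x: "x \<in> U" and f: "f \<in> hol X U" and zero: "\<And>z. z \<in> U \<Longrightarrow> z \<noteq> x \<Longrightarrow> f z = 0"
  shows "f x = 0"
proof (rule ccontr)
  assume "f x \<noteq> 0"
  then have "{z \<in> U. f z \<noteq> 0} = {x}" using zero x by auto
  then show False using opn_nonzero[OF U f] not_opn_singleton by simp
qed

text \<open>The extensions at the various points over \<open>x\<close> fit together because the iterates of \<open>hopf_map\<close> carry the
  limit at one of them to the limit at another.\<close>

lemma hartogs_quotient: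
  assumes U: "opn U" and x: "x \<in> U" and Ux: "opn (U - {x})" and f: "f \<in> hol X (U - {x})"
  obtains c where "f(x := c) \<in> hol X U"
proof -
  define h where "h = (\<lambda>z. f (q z))"
  have h: "holomorphic2_on h (pre (U - {x}))" using f hol_iff[OF Ux] by (simp add: h_def)
  have loc: "\<exists>c S. open S \<and> z \<in> S \<and> S \<subseteq> pre U \<and> S - {z} \<subseteq> pre (U - {x}) \<and> holomorphic2_on (h(z := c)) S"
    if z: "z \<noteq> 0" "q z = x" for z
  proof -
    \<comment> \<open>In \<open>T\<close> the point \<open>z\<close> is the only one over
      \<open>x\<close>, so \<open>h\<close> has a single puncture there and the theorem in the plane
      applies.\<close>
    obtain T where T: "open T" "z \<in> T" "\<And>w. w \<in> T \<Longrightarrow> w \<noteq> 0 \<Longrightarrow> w \<noteq> z \<Longrightarrow> q w \<noteq> q z"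
      using fibre_discrete z(1) by metis
    have S: "open (T \<inter> pre U)" "z \<in> T \<inter> pre U" "T \<inter> pre U - {z} \<subseteq> pre (U - {x})"
      using T z x open_pre[OF U] by (auto simp: pre_def)
    obtain c where "holomorphic2_on (h(z := c)) (T \<inter> pre U)"
      using hartogs_point[OF S(1,2) holomorphic2_on_subset[OF h S(3)]] by blast
    then show ?thesis using S by blast
  qed
  have lim: "(h \<longlongrightarrow> c) (at z)" if "open S" "z \<in> S" "holomorphic2_on (h(z := c)) S" for c S z
  proof -
    have "isCont (h(z := c)) z"
      using that holomorphic2_on_continuous continuous_on_eq_continuous_at by blast
    then have "((h(z := c)) \<longlongrightarrow> c) (at z)" by (simp add: isCont_def)
    then show ?thesis
      by (rule Lim_transform_within_open[OF _ that(1,2)]) auto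
  qed
  have lim_shift: "c = d"
    if z: "z \<noteq> 0" and w: "(hopf_map a b \<mu> r ^^ n) z = w" and c: "(h \<longlongrightarrow> c) (at z)" and d: "(h \<longlongrightarrow> d) (at w)"
    for z w c d n
  proof -
    let ?g = "hopf_map a b \<mu> r ^^ n"
    have "(?g \<longlongrightarrow> w) (at z)"
      using continuous_hopf_map_power[of n] unfolding w[symmetric] continuous_on_def by blast
    \<comment> \<open>Injectivity keeps the iterate away from \<open>w\<close>, so the limit at
      \<open>w\<close>, which ignores the value there, can be composed with it.\<close>
    moreover have "\<forall>\<^sub>F y in at z. ?g y \<noteq> w"
      using w inj_fn[OF inj_hopf_map, of n] by (auto simp: eventually_at_filter inj_eq)
    ultimately have "filterlim ?g (at w) (at z)" by (simp add: filterlim_at)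
    with d have lim1: "((\<lambda>y. h (?g y)) \<longlongrightarrow> d) (at z)" by (rule filterlim_compose)
    have "\<forall>\<^sub>F y in at z. y \<in> - {0} - {z}"
      by (rule eventually_at_in_open) (use z in auto)
    then have "\<forall>\<^sub>F y in at z. h (?g y) = h y"
    proof eventually_elim
      case (elim y)
      then have "q y = q (?g y)" using fibre[of y "?g y"] hopf_map_power_nonzero[of y n] by auto
      then show ?case by (simp add: h_def)
    qed
    with lim1 have "(h \<longlongrightarrow> d) (at z)" using tendsto_cong by force
    then show ?thesis using tendsto_unique[OF trivial_limit_at c] by blast
  qed
  obtain z0 where z0: "z0 \<noteq> 0" "q z0 = x" using q_surj opn_points[OF U x] by blast
  then obtain c S0 where S0: "open S0" "z0 \<in> S0" "holomorphic2_on (h(z0 := c)) S0" using loc by metis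
  have "f(x := c) \<in> hol X U"
    unfolding hol_iff[OF U]
  proof (rule holomorphic2_on_open_local)
    fix z assume z: "z \<in> pre U"
    show "\<exists>T. open T \<and> z \<in> T \<and> holomorphic2_on (\<lambda>z. (f(x := c)) (q z)) (T \<inter> pre U)"
    proof (cases "q z = x")
      case False
      show ?thesis
      proof (intro exI conjI)
        show "open (pre (U - {x}))" by (rule open_pre[OF Ux])
        show "z \<in> pre (U - {x})" using z False by (auto simp: pre_def)
        show "holomorphic2_on (\<lambda>z. (f(x := c)) (q z)) (pre (U - {x}) \<inter> pre U)"
          by (rule holomorphic2_on_cong[OF _ holomorphic2_on_subset[OF h]]) (auto simp: pre_def h_def)
      qed
    next
      case True
      have zn: "z \<noteq> 0" using z by (auto simp: pre_def)
      obtain d S where S: "open S" "z \<in> S" "S \<subseteq> pre U" "S - {z} \<subseteq> pre (U - {x})"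
        and d: "holomorphic2_on (h(z := d)) S"
        using loc[OF zn True] by metis
      obtain n where "(hopf_map a b \<mu> r ^^ n) z = z0 \<or> (hopf_map a b \<mu> r ^^ n) z0 = z"
        using fibre[OF zn z0(1)] True z0(2) by auto
      then have "d = c"
        using lim_shift lim[OF S(1,2) d] lim[OF S0] zn z0(1) by metis
      moreover have "(h(z := c)) w = (f(x := c)) (q w)" if "w \<in> S" for w
        using that S(4) True by (auto simp: pre_def h_def)
      ultimately have "holomorphic2_on (\<lambda>z. (f(x := c)) (q z)) S"
        using d holomorphic2_on_cong by metis
      then show ?thesis using S by (metis Int_absorb2)
    qed
  qed
  then show thesis by (rule that)
qed

text \<open>With \<open>f\<close> nonzero off \<open>x\<close>, its inverse extends across
  \<open>x\<close> by Hartogs. The product of \<open>f\<close> and the extension is 1 off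
  \<open>x\<close>, hence also at \<open>x\<close>.\<close>

lemma no_isolated_zero:
  assumes U: "opn U" and x: "x \<in> U" and Ux: "opn (U - {x})" and f: "f \<in> hol X U"
    and ne: "\<And>z. z \<in> U \<Longrightarrow> z \<noteq> x \<Longrightarrow> f z \<noteq> 0"
  shows "f x \<noteq> 0"
proof -
  have "(\<lambda>z. inverse (f z)) \<in> hol X (U - {x})"
    using hol_inverse[OF Ux hol_subset[OF U f Ux]] ne by auto
  then obtain c where c: "(\<lambda>z. inverse (f z))(x := c) \<in> hol X U"
    using hartogs_quotient[OF U x Ux] by blast
  have "f x * ((\<lambda>z. inverse (f z))(x := c)) x - 1 = 0"
    by (rule hol_eq_zero_at[OF U x hol_diff[OF U hol_mult[OF U f c] hol_const[OF U]]]) (simp add: ne)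
  then show ?thesis by auto
qed

text \<open>The function \<open>g\<close> is a section of the line bundle with local frames \<open>\<theta> x\<close>.\<close>

lemma section_identity:
  assumes U: "\<And>x. x \<in> points X \<Longrightarrow> opn (U x) \<and> x \<in> U x"
    and \<theta>: "\<And>x z. x \<in> points X \<Longrightarrow> z \<in> U x \<Longrightarrow> \<theta> x z \<noteq> 0"
    and hol: "\<And>x. x \<in> points X \<Longrightarrow> (\<lambda>z. \<theta> x z * g z) \<in> hol X (U x)"
    and W: "opn W" "W \<noteq> {}" "\<And>z. z \<in> W \<Longrightarrow> g z = 0" and x: "x \<in> points X"
  shows "g x = (0::complex)"
proof -
  \<comment> \<open>\<open>A\<close> consists of the points of the punctured plane near which the
    pullback of \<open>g\<close> vanishes. It is open by construction; once it is also closed,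
    connectedness of the punctured plane leaves no other points.\<close>
  define A where "A = interior {z. z \<noteq> 0 \<and> g (q z) = 0}"
  have "pre W \<subseteq> A"
    unfolding A_def by (rule interior_maximal) (use W open_pre in \<open>auto simp: pre_def\<close>)
  moreover have "pre W \<noteq> {}"
    using W q_surj opn_points unfolding pre_def by blast
  ultimately have A_ne: "A \<noteq> {}" by auto
  have A_sub: "A \<subseteq> - {0}" unfolding A_def using interior_subset by blast
  have "closedin (top_of_set (- {0})) A"
    unfolding closedin_limpt
  proof (intro conjI allI impI A_sub)
    \<comment> \<open>A ball around the limit point over which a single frame is defined meets
      \<open>A\<close> in a nonempty open set. The identity theorem makes
      \<open>\<theta> * g\<close> vanish on the whole ball, and \<open>\<theta>\<close> has no
      zeros.\<close>
    fix z assume z: "z islimpt A \<and> z \<in> - {0}"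
    then have qz: "q z \<in> points X" using q_points by auto
    have "open (pre (U (q z)))" "z \<in> pre (U (q z))" using U[OF qz] z open_pre by (auto simp: pre_def)
    then obtain e where e: "e > 0" "ball z e \<subseteq> pre (U (q z))" using openE by blast
    have F: "holomorphic2_on (\<lambda>w. \<theta> (q z) (q w) * g (q w)) (ball z e)"
      using hol[OF qz] U[OF qz] e(2) holomorphic2_on_subset by (simp add: hol_iff)
    obtain w where w: "w \<in> A" "w \<in> ball z e"
      using z e(1) unfolding islimpt_def by (metis centre_in_ball open_ball)
    have "g (q v) = 0" if v: "v \<in> ball z e" for v
    proof -
      have "\<theta> (q z) (q v) * g (q v) = 0"
        by (rule holomorphic2_identity_convex[OF open_ball convex_ball F, of "A \<inter> ball z e" w v])
          (use w v interior_subset in \<open>auto simp: A_def\<close>)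
      then show ?thesis using \<theta>[OF qz] v e(2) by (auto simp: pre_def)
    qed
    then have "ball z e \<subseteq> A"
      unfolding A_def by (intro interior_maximal) (use e(2) in \<open>auto simp: pre_def\<close>)
    then show "z \<in> A" using e(1) by auto
  qed
  moreover have "openin (top_of_set (- {0})) A"
    using A_sub by (simp add: A_def openin_open_eq open_Compl)
  moreover have "connected (- {0 :: complex \<times> complex})"
    by (rule connected_punctured_universe) (simp add: DIM_prod)
  ultimately have "A = - {0}" using A_ne connected_clopen by blast
  then show ?thesis using q_surj[OF x] interior_subset unfolding A_def by blast
qed

text \<open>If \<open>g\<close> were nonzero somewhere, then by \<open>section_identity\<close> none
  of the functions \<open>\<theta> x * g\<close> would vanish on a nonempty open set. They would be
  local equations of an effective divisor, with units \<open>\<theta> x / \<theta> y\<close>, whose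
  support contains \<open>S\<close>.\<close>

lemma section_vanishing_on_nondivisor:
  assumes U: "\<And>x. x \<in> points X \<Longrightarrow> opn (U x) \<and> x \<in> U x"
    and \<theta>: "\<And>x z. x \<in> points X \<Longrightarrow> z \<in> U x \<Longrightarrow> \<theta> x z \<noteq> 0"
    and cocycle: "\<And>x y. x \<in> points X \<Longrightarrow> y \<in> points X \<Longrightarrow> (\<lambda>z. \<theta> x z / \<theta> y z) \<in> hol X (U x \<inter> U y)"
    and hol: "\<And>x. x \<in> points X \<Longrightarrow> (\<lambda>z. \<theta> x z * g z) \<in> hol X (U x)"
    and S: "S \<subseteq> points X" "\<not> contained_in_divisor X S" "\<And>z. z \<in> S \<Longrightarrow> g z = 0" and x: "x \<in> points X"
  shows "g x = (0::complex)"
proof (rule ccontr)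
  assume gx: "g x \<noteq> 0"
  have "effective_divisor X U (\<lambda>x z. \<theta> x z * g z)"
    unfolding effective_divisor_def
  proof (intro conjI ballI allI impI)
    fix x y assume xy: "x \<in> points X" "y \<in> points X"
    show "\<exists>u\<in>hol X (U x \<inter> U y). \<forall>z\<in>U x \<inter> U y. u z \<noteq> 0 \<and> \<theta> x z * g z = u z * (\<theta> y z * g z)"
      by (rule bexI[OF _ cocycle[OF xy]]) (use \<theta> xy in auto)
  next
    fix y W assume y: "y \<in> points X" and W: "opn W \<and> W \<noteq> {} \<and> W \<subseteq> U y"
    then obtain z where "z \<in> W" "g z \<noteq> 0"
      using section_identity[OF U \<theta> hol _ _ _ x, of W] gx by blast
    then show "\<exists>z\<in>W. \<theta> y z * g z \<noteq> 0" using \<theta>[OF y] W by auto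
  qed (use U hol in auto)
  moreover have "S \<subseteq> divisor_support X (\<lambda>x z. \<theta> x z * g z)"
    using S by (auto simp: divisor_support_def)
  ultimately show False using S(2) unfolding contained_in_divisor_def by blast
qed

end

section \<open>Local frames and Serre sequences\<close>

lemma matrix_inv_cancel:
  fixes A :: "'a::semiring_1^'n^'m"
  assumes "invertible A"
  shows "A ** matrix_inv A = mat 1" "matrix_inv A ** A = mat 1"
proof -
  have "\<exists>A'. A ** A' = mat 1 \<and> A' ** A = mat 1"
    using assms unfolding invertible_def by blast
  then have "A ** matrix_inv A = mat 1 \<and> matrix_inv A ** A = mat 1"
    unfolding matrix_inv_def by (rule someI_ex)
  then show "A ** matrix_inv A = mat 1" "matrix_inv A ** A = mat 1" by auto
qed

lemma matrix_inv_cancel_mult: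
  fixes A :: "'a::semiring_1^'n^'m"
  assumes "invertible A"
  shows "B ** A ** matrix_inv A = B" "C ** matrix_inv A ** A = C"
    "A ** (matrix_inv A ** D) = D" "matrix_inv A ** (A ** F) = F"
    "A *v (matrix_inv A *v v) = v" "matrix_inv A *v (A *v w) = w"
proof -
  note c = matrix_inv_cancel[OF assms]
  show "B ** A ** matrix_inv A = B" "C ** matrix_inv A ** A = C"
    by (simp_all only: matrix_mul_assoc[symmetric] c matrix_mul_rid)
  show "A ** (matrix_inv A ** D) = D" "matrix_inv A ** (A ** F) = F"
    by (simp_all only: matrix_mul_assoc c matrix_mul_lid)
  show "A *v (matrix_inv A *v v) = v" "matrix_inv A *v (A *v w) = w"
    by (simp_all only: matrix_vector_mul_assoc c matrix_vector_mul_lid)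
qed

lemma invertible_matrix_inv:
  fixes A :: "'a::semiring_1^'n^'m"
  assumes "invertible A"
  shows "invertible (matrix_inv A)"
  using matrix_inv_cancel[OF assms] unfolding invertible_def by blast

lemma matrix_mult_eq_0_cancel:
  fixes A :: "'a::semiring_1^'n^'n"
  assumes "invertible A"
  shows "A ** B = 0 \<longleftrightarrow> B = 0" "C ** A = 0 \<longleftrightarrow> C = 0"
proof -
  have z': "M ** (0 :: 'a^_^'n) = 0" for M :: "'a^'n^'n"
    by (simp add: matrix_matrix_mult_def vec_eq_iff)
  have z'': "(0 :: 'a^'n^_) ** M = 0" for M :: "'a^'n^'n"
    by (simp add: matrix_matrix_mult_def vec_eq_iff)
  show "A ** B = 0 \<longleftrightarrow> B = 0"
    using matrix_inv_cancel_mult(4)[OF assms, of B] z' by metis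
  show "C ** A = 0 \<longleftrightarrow> C = 0"
    using matrix_inv_cancel_mult(1)[OF assms, of C] z'' by metis
qed

lemma mult_1_1: "((A :: complex^1^1) ** B) $ 1 $ 1 = A $ 1 $ 1 * B $ 1 $ 1"
  by (simp add: matrix_matrix_mult_def sum_1)

lemma matrix_1_1_eq_0: "(A :: complex^1^1) = 0 \<longleftrightarrow> A $ 1 $ 1 = 0"
  by (simp add: vec_eq_iff)

lemma invertible_1_1:
  assumes "invertible (A :: complex^1^1)"
  shows "A $ 1 $ 1 \<noteq> 0" "matrix_inv A $ 1 $ 1 = inverse (A $ 1 $ 1)"
proof -
  have "(A ** matrix_inv A) $ 1 $ 1 = 1"
    by (simp add: matrix_inv_cancel(1)[OF assms] mat_def)
  then have "A $ 1 $ 1 * matrix_inv A $ 1 $ 1 = 1"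
    by (simp add: mult_1_1)
  then show "A $ 1 $ 1 \<noteq> 0" "matrix_inv A $ 1 $ 1 = inverse (A $ 1 $ 1)"
    by (auto simp: inverse_unique)
qed

lemma trace_conj:
  fixes A B :: "complex^'n^'n"
  assumes "invertible A"
  shows "trace (A ** B ** matrix_inv A) = trace B"
  using trace_mul_sym[of "A ** B" "matrix_inv A"] matrix_inv_cancel_mult(4)[OF assms, of B] by simp

lemma det_conj:
  fixes A B :: "complex^'n^'n"
  assumes "invertible A"
  shows "det (A ** B ** matrix_inv A) = det B"
proof -
  have "det A * det (matrix_inv A) = 1"
    using matrix_inv_cancel(1)[OF assms] by (metis det_mul det_I)
  then show ?thesis by (simp add: det_mul)
qed

section \<open>Bundles, morphisms and sections in coordinates\<close>

context hopf_quotient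
begin

definition hol_mat :: "'a set \<Rightarrow> ('a \<Rightarrow> complex^'n^'m) \<Rightarrow> bool" where
  "hol_mat U M \<longleftrightarrow> (\<forall>i j. (\<lambda>z. M z $ i $ j) \<in> hol X U)"

definition hol_vec :: "'a set \<Rightarrow> ('a \<Rightarrow> complex^'n) \<Rightarrow> bool" where
  "hol_vec U v \<longleftrightarrow> (\<forall>i. (\<lambda>z. v z $ i) \<in> hol X U)"

lemma hol_mat_mult:
  fixes M :: "'a \<Rightarrow> complex^'n::finite^'m"
  shows "opn U \<Longrightarrow> hol_mat U M \<Longrightarrow> hol_mat U N \<Longrightarrow> hol_mat U (\<lambda>z. M z ** N z)"
  unfolding hol_mat_def matrix_matrix_mult_def
  by (auto intro!: hol_sum hol_mult)

lemma hol_mat_vec_mult: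
  fixes M :: "'a \<Rightarrow> complex^'n::finite^'m"
  shows "opn U \<Longrightarrow> hol_mat U M \<Longrightarrow> hol_vec U v \<Longrightarrow> hol_vec U (\<lambda>z. M z *v v z)"
  unfolding hol_mat_def hol_vec_def matrix_vector_mult_def
  by (auto intro!: hol_sum hol_mult)

lemma hol_mat_subset: "opn U \<Longrightarrow> hol_mat U M \<Longrightarrow> opn V \<Longrightarrow> V \<subseteq> U \<Longrightarrow> hol_mat V M"
  unfolding hol_mat_def using hol_subset by blast

lemma hol_vec_subset: "opn U \<Longrightarrow> hol_vec U M \<Longrightarrow> opn V \<Longrightarrow> V \<subseteq> U \<Longrightarrow> hol_vec V M"
  unfolding hol_vec_def using hol_subset by blast

lemma hol_vec_cong: "opn U \<Longrightarrow> hol_vec U M \<Longrightarrow> (\<And>z. z \<in> U \<Longrightarrow> M z = N z) \<Longrightarrow> hol_vec U N"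
  unfolding hol_vec_def using hol_cong[of U "\<lambda>z. M z $ _"] by simp

lemma hol_vec_const: "opn U \<Longrightarrow> hol_vec U (\<lambda>_. v)"
  unfolding hol_vec_def by (simp add: hol_const)

lemma chartD:
  assumes "vector_bundle X F" "x \<in> points X"
  shows "opn (chart F x)" "x \<in> chart F x" "z \<in> chart F x \<Longrightarrow> invertible (triv F x z)"
  using assms unfolding vector_bundle_def by auto

lemma transition_hol:
  assumes "vector_bundle X F" "x \<in> points X" "y \<in> points X"
  shows "hol_mat (chart F x \<inter> chart F y) (\<lambda>z. triv F x z ** matrix_inv (triv F y z))"
  using assms unfolding vector_bundle_def hol_mat_def by auto

lemma bundle_hom_hol:
  assumes "bundle_hom X F G \<phi>" "x \<in> points X" "y \<in> points X"
  shows "hol_mat (chart G x \<inter> chart F y) (\<lambda>z. triv G x z ** \<phi> z ** matrix_inv (triv F y z))"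
  using assms unfolding bundle_hom_def hol_mat_def by auto

lemma sections_coords:
  "s \<in> sections X F V \<Longrightarrow> x \<in> points X \<Longrightarrow> hol_vec (V \<inter> chart F x) (\<lambda>z. triv F x z *v s z)"
  unfolding sections_def hol_vec_def by blast

text \<open>Supplies the test sections to which the sheaf-theoretic conditions in
  \<open>serre_sequence\<close> are applied. In any other chart the coordinates are \<open>w\<close>
  multiplied by a holomorphic transition matrix.\<close>

lemma sections_frame:
  assumes F: "vector_bundle X F" and x: "x \<in> points X" and V: "opn V" "V \<subseteq> chart F x"
    and hol: "hol_vec V w"
  shows "(\<lambda>z. if z \<in> V then matrix_inv (triv F x z) *v w z else 0) \<in> sections X F V"
proof -
  let ?s = "\<lambda>z. if z \<in> V then matrix_inv (triv F x z) *v w z else 0"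
  have coords: "hol_vec (V \<inter> chart F y) (\<lambda>z. triv F y z *v ?s z)" if y: "y \<in> points X" for y
  proof -
    have o: "opn (V \<inter> chart F y)" using V chartD[OF F y] by blast
    have "hol_vec (V \<inter> chart F y) (\<lambda>z. (triv F y z ** matrix_inv (triv F x z)) *v w z)"
    proof (rule hol_mat_vec_mult[OF o])
      show "hol_mat (V \<inter> chart F y) (\<lambda>z. triv F y z ** matrix_inv (triv F x z))"
        by (rule hol_mat_subset[OF _ transition_hol[OF F y x] o])
          (use V chartD[OF F y] chartD[OF F x] in auto)
    qed (use V o hol hol_vec_subset in blast)
    then show ?thesis
      by (rule hol_vec_cong[OF o]) (simp add: matrix_vector_mul_assoc)
  qed
  show ?thesis
    unfolding sections_def
  proof (intro CollectI conjI allI impI ballI)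
    show "(\<lambda>z. (triv F y z *v ?s z) $ i) \<in> hol X (V \<inter> chart F y)" if "y \<in> points X" for y i
      using coords[OF that] unfolding hol_vec_def by (rule spec)
  qed simp
qed

end

section \<open>The Serre sequence in local frames\<close>

locale serre_extension = hopf_quotient +
  fixes E :: "('a, 2) vbundle" and L1 L2 H :: "('a, 1) vbundle"
    and \<iota> :: "'a \<Rightarrow> complex^1^2" and p :: "'a \<Rightarrow> complex^2^1"
    and I :: "'a set \<Rightarrow> ('a \<Rightarrow> complex) set"
  assumes E: "vector_bundle X E" and L1: "line_bundle X L1" and L2: "line_bundle X L2"
    and H: "line_bundle X H"
    and Z: "zero_dimensional_subspace X I"
    and serre: "serre_sequence X L1 \<iota> E p L2 I"
    and not_div: "\<not> contained_in_divisor X (subspace_support X I)"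
begin

definition S :: "'a set" where "S = subspace_support X I"

definition frame :: "'a \<Rightarrow> 'a set" where
  "frame x = chart E x \<inter> chart L1 x \<inter> chart L2 x \<inter> chart H x"

text \<open>The holomorphic matrix of \<open>\<iota>\<close> over \<open>frame x\<close>. The
  matrices \<open>\<iota> z\<close> refer to bases of the single fibres and may jump with
  \<open>z\<close>; the same distinction applies to \<open>p\<close> and
  \<open>p_loc\<close>.\<close>

definition \<iota>_loc :: "'a \<Rightarrow> 'a \<Rightarrow> complex^1^2" where
  "\<iota>_loc x z = triv E x z ** \<iota> z ** matrix_inv (triv L1 x z)"

definition p_loc :: "'a \<Rightarrow> 'a \<Rightarrow> complex^2^1" where
  "p_loc x z = triv L2 x z ** p z ** matrix_inv (triv E x z)"

lemmas charts = chartD[OF E] chartD[OF L1] chartD[OF L2] chartD[OF H]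

lemma opn_frame: "x \<in> points X \<Longrightarrow> opn (frame x)"
  unfolding frame_def by (intro openin_Int charts)

lemma in_frame: "x \<in> points X \<Longrightarrow> x \<in> frame x"
  unfolding frame_def using charts by blast

lemma invertible_frame:
  assumes "x \<in> points X" "z \<in> frame x"
  shows "invertible (triv E x z)" "invertible (triv L1 x z)" "invertible (triv L2 x z)" "invertible (triv H x z)"
  using assms charts unfolding frame_def by blast+

lemma \<iota>_loc_hol: "x \<in> points X \<Longrightarrow> hol_mat (frame x) (\<iota>_loc x)"
  unfolding \<iota>_loc_def
  by (rule hol_mat_subset[OF _ bundle_hom_hol[of L1 E \<iota> x x]])
    (use serre charts opn_frame in \<open>auto simp: serre_sequence_def frame_def\<close>)

lemma p_loc_hol: "x \<in> points X \<Longrightarrow> hol_mat (frame x) (p_loc x)"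
  unfolding p_loc_def
  by (rule hol_mat_subset[OF _ bundle_hom_hol[of E L2 p x x]])
    (use serre charts opn_frame in \<open>auto simp: serre_sequence_def frame_def\<close>)

lemma p_loc_eq_0: "x \<in> points X \<Longrightarrow> z \<in> frame x \<Longrightarrow> p_loc x z = 0 \<longleftrightarrow> p z = 0"
  using invertible_frame[of x z] by (simp add: p_loc_def matrix_mult_eq_0_cancel invertible_matrix_inv)

lemma \<iota>_loc_eq_0: "x \<in> points X \<Longrightarrow> z \<in> frame x \<Longrightarrow> \<iota>_loc x z = 0 \<longleftrightarrow> \<iota> z = 0"
  using invertible_frame[of x z] by (simp add: \<iota>_loc_def matrix_mult_eq_0_cancel invertible_matrix_inv)

lemma I_sheaf: "ideal_sheaf X I"
  using Z unfolding zero_dimensional_subspace_def by blast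

lemmas I_on = I_sheaf[unfolded ideal_sheaf_def, THEN spec, THEN mp]

lemma I_restrict: "opn U \<Longrightarrow> f \<in> I U \<Longrightarrow> opn V \<Longrightarrow> V \<subseteq> U \<Longrightarrow> f \<in> I V"
  by (drule I_on, elim conjE) blast

lemma I_mult: "opn U \<Longrightarrow> f \<in> I U \<Longrightarrow> h \<in> hol X U \<Longrightarrow> (\<lambda>z. h z * f z) \<in> I U"
  by (drule I_on, elim conjE) simp

lemma I_cong: "opn U \<Longrightarrow> f \<in> I U \<Longrightarrow> (\<And>z. z \<in> U \<Longrightarrow> g z = f z) \<Longrightarrow> g \<in> I U"
  by (drule I_on, elim conjE) simp

lemma I_hol: "opn U \<Longrightarrow> f \<in> I U \<Longrightarrow> f \<in> hol X U"
  by (drule I_on, elim conjE) (simp add: subset_iff)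

lemmas serre_on = serre[unfolded serre_sequence_def, THEN conjunct2, THEN conjunct2, THEN spec, THEN mp]
lemmas serre_ideal = serre_on[THEN conjunct1, THEN bspec]
lemmas serre_exact = serre_on[THEN conjunct2, THEN conjunct2, THEN conjunct1, THEN bspec]
lemmas serre_surj = serre_on[THEN conjunct2, THEN conjunct2, THEN conjunct2, THEN bspec, THEN bspec]

lemma S_points: "S \<subseteq> points X"
  unfolding S_def subspace_support_def by blast

text \<open>The support is closed: an open set on which the ideal contains 1 misses it
  entirely.\<close>

lemma opn_minus_S: "opn U \<Longrightarrow> opn (U - S)"
proof -
  assume U: "opn U"
  have "opn (points X - S)"
  proof (subst openin_subopen, rule ballI)
    fix x assume "x \<in> points X - S"
    then obtain V where V: "opn V" "x \<in> V" "(\<lambda>_. 1) \<in> I V"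
      unfolding S_def subspace_support_def by blast
    then have "V \<subseteq> points X - S"
      using openin_subset[of "top_of X" V] unfolding S_def subspace_support_def by blast
    with V show "\<exists>T. opn T \<and> x \<in> T \<and> T \<subseteq> points X - S" by blast
  qed
  then have "opn (U \<inter> (points X - S))" using U by blast
  moreover have "U \<inter> (points X - S) = U - S" using openin_subset[OF U] by auto
  ultimately show ?thesis by simp
qed

lemma isolating:
  assumes "x \<in> S" "opn U" "x \<in> U"
  obtains V where "opn V" "x \<in> V" "V \<subseteq> U" "V \<inter> S = {x}"
proof -
  obtain W where "opn W" "W \<inter> S = {x}"
    using Z assms(1) unfolding zero_dimensional_subspace_def S_def by blast
  then show thesis using assms by (intro that[of "W \<inter> U"]) auto
qed

text \<open>A member of the ideal that is nonzero at \<open>x\<close> is a unit near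
  \<open>x\<close>, so the ideal would contain 1 there and \<open>x\<close> would lie outside the
  support.\<close>

lemma ideal_zero:
  assumes f: "f \<in> I U" and U: "opn U" and x: "x \<in> U" "x \<in> S"
  shows "f x = 0"
proof (rule ccontr)
  assume fx: "f x \<noteq> 0"
  define V where "V = {z \<in> U. f z \<noteq> 0}"
  have V: "opn V" "V \<subseteq> U" unfolding V_def using opn_nonzero[OF U I_hol[OF U f]] by auto
  have fV: "f \<in> I V" using I_restrict[OF U f V] .
  have "(\<lambda>z. inverse (f z) * f z) \<in> I V"
    by (rule I_mult[OF V(1) fV hol_inverse[OF V(1) I_hol[OF V(1) fV]]]) (simp add: V_def)
  then have "(\<lambda>_. 1) \<in> I V"
    by (rule I_cong[OF V(1)]) (simp add: V_def)
  then show False using x fx V(1) unfolding S_def subspace_support_def by (auto simp: V_def)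
qed

text \<open>The image under \<open>p\<close> of the \<open>j\<close>-th frame section of
  \<open>E\<close> has its coordinate in the ideal, which vanishes on the support; that coordinate
  is the \<open>j\<close>-th entry of \<open>p_loc\<close>.\<close>

lemma p_zero:
  assumes x: "x \<in> S"
  shows "p x = 0"
proof -
  have xp: "x \<in> points X" using x S_points by blast
  note V = opn_frame[OF xp] in_frame[OF xp]
  have "p_loc x x $ 1 $ j = 0" for j
  proof -
    let ?s = "\<lambda>z. if z \<in> frame x then matrix_inv (triv E x z) *v axis j 1 else 0"
    have "?s \<in> sections X E (frame x)"
      by (rule sections_frame[OF E xp V(1) _ hol_vec_const[OF V(1)]]) (auto simp: frame_def)
    then have "(\<lambda>z. p z *v ?s z) \<in> ideal_sections X L2 I (frame x)"
      by (rule serre_ideal[OF V(1)])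
    then have "(\<lambda>z. (triv L2 x z *v (p z *v ?s z)) $ 1) \<in> I (frame x \<inter> chart L2 x)"
      unfolding ideal_sections_def using xp by blast
    then have "(triv L2 x x *v (p x *v ?s x)) $ 1 = 0"
      by (rule ideal_zero) (use V x chartD[OF L2 xp] in auto)
    then have "(p_loc x x *v axis j 1) $ 1 = 0"
      using V(2) by (simp add: p_loc_def matrix_vector_mul_assoc matrix_mul_assoc)
    moreover have "(p_loc x x *v axis j 1) $ 1 = p_loc x x $ 1 $ j"
      by (simp add: matrix_vector_mult_def axis_def if_distrib cong: if_cong)
    ultimately show ?thesis by simp
  qed
  then have "p_loc x x = 0" by (simp add: vec_eq_iff)
  then show ?thesis using p_loc_eq_0[OF xp V(2)] by simp
qed

lemma p_\<iota>:
  assumes x: "x \<in> points X"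
  shows "p x ** \<iota> x = 0"
proof -
  note V = opn_frame[OF x] in_frame[OF x]
  let ?t = "\<lambda>z. if z \<in> frame x then matrix_inv (triv L1 x z) *v 1 else 0"
  have t: "?t \<in> sections X L1 (frame x)"
    by (rule sections_frame[OF L1 x V(1) _ hol_vec_const[OF V(1)]]) (auto simp: frame_def)
  \<comment> \<open>This is \<open>\<iota>\<close> applied to \<open>?t\<close>, written with
    \<open>\<iota>_loc\<close> so that its coordinates in \<open>E\<close> are visibly holomorphic;
    \<open>st\<close> records the equality.\<close>
  let ?s = "\<lambda>z. if z \<in> frame x then matrix_inv (triv E x z) *v (\<iota>_loc x z *v 1) else 0"
  have s: "?s \<in> sections X E (frame x)"
    by (rule sections_frame[OF E x V(1) _ hol_mat_vec_mult[OF V(1) \<iota>_loc_hol[OF x] hol_vec_const[OF V(1)]]])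
      (auto simp: frame_def)
  have st: "matrix_inv (triv E x z) *v (\<iota>_loc x z *v 1) = \<iota> z *v (matrix_inv (triv L1 x z) *v 1)"
    if "z \<in> frame x" for z
    using that invertible_frame[OF x that]
    by (simp add: \<iota>_loc_def matrix_vector_mul_assoc[symmetric] matrix_inv_cancel_mult(6))
  have "\<forall>y\<in>frame x. \<exists>V. opn V \<and> y \<in> V \<and> V \<subseteq> frame x \<and> (\<exists>t\<in>sections X L1 V. \<forall>z\<in>V. ?s z = \<iota> z *v t z)"
    by (intro ballI exI[of _ "frame x"] conjI bexI[OF _ t]) (simp_all add: V(1) st)
  then have "\<forall>z\<in>frame x. p z *v ?s z = 0"
    using serre_exact[OF V(1) s] by (rule iffD2[rotated])
  then have "p x *v ?s x = 0" using V(2) by blast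
  then have "(p x ** \<iota> x ** matrix_inv (triv L1 x x)) *v 1 = 0"
    using st[OF V(2)] V(2) by (simp add: matrix_vector_mul_assoc[symmetric])
  then have "p x ** \<iota> x ** matrix_inv (triv L1 x x) = 0"
    by (simp add: vec_eq_iff matrix_vector_mult_def sum_1)
  then show ?thesis
    using invertible_frame[OF x V(2)] by (simp add: matrix_mult_eq_0_cancel invertible_matrix_inv)
qed

text \<open>Near a point off the support the ideal is the whole structure sheaf, so the frame
  section of \<open>L2\<close> belongs to \<open>L2 \<otimes> I\<close> and lifts locally through
  \<open>p\<close>. Where \<open>p\<close> vanishes a nonzero value cannot be lifted.\<close>

lemma p_nonzero:
  assumes x: "x \<in> points X" "x \<notin> S"
  shows "p x \<noteq> 0"
proof
  assume px: "p x = 0"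
  obtain W where W: "opn W" "x \<in> W" "(\<lambda>_. 1) \<in> I W"
    using x unfolding S_def subspace_support_def by blast
  define V where "V = W \<inter> frame x"
  have V: "opn V" "x \<in> V" "V \<subseteq> W" "V \<subseteq> frame x"
    using W opn_frame[OF x(1)] in_frame[OF x(1)] by (auto simp: V_def)
  \<comment> \<open>An ideal containing 1 contains every holomorphic function.\<close>
  have full: "f \<in> I V'" if "opn V'" "V' \<subseteq> V" "f \<in> hol X V'" for f V'
    using I_mult[OF that(1) I_restrict[OF W(1,3) that(1)] that(3)] that(2) V(3) by simp
  let ?s = "\<lambda>z. if z \<in> V then matrix_inv (triv L2 x z) *v 1 else 0"
  have s: "?s \<in> sections X L2 V"
    by (rule sections_frame[OF L2 x(1) V(1) _ hol_vec_const[OF V(1)]]) (use V in \<open>auto simp: frame_def\<close>)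
  have "?s \<in> ideal_sections X L2 I V"
    unfolding ideal_sections_def
  proof (intro CollectI conjI ballI allI s)
    fix y i assume y: "y \<in> points X"
    show "(\<lambda>z. (triv L2 y z *v ?s z) $ i) \<in> I (V \<inter> chart L2 y)"
    proof (rule full)
      show "(\<lambda>z. (triv L2 y z *v ?s z) $ i) \<in> hol X (V \<inter> chart L2 y)"
        using sections_coords[OF s y] unfolding hol_vec_def by (rule spec)
    qed (use V chartD[OF L2 y] in auto)
  qed
  from serre_surj[OF V(1) this V(2)] obtain V' t where "x \<in> V'" "\<forall>z\<in>V'. p z *v t z = ?s z"
    by blast
  then have "?s x = 0" using px by force
  then have "matrix_inv (triv L2 x x) *v 1 = 0" using V(2) by simp
  then have "(1 :: complex^1) = 0"
    using matrix_inv_cancel_mult(5)[OF invertible_frame(3)[OF x(1) in_frame[OF x(1)]], of 1] by simp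
  then show False by simp
qed

text \<open>Exactness at \<open>E\<close> in coordinates. The multiplier \<open>\<tau>\<close> is
  the coordinate of a section of \<open>L1\<close>, hence holomorphic even at points where
  \<open>\<iota>_loc\<close> vanishes and division would say nothing.\<close>

lemma lift_to_L1:
  assumes x: "x \<in> points X" and V: "opn V" "x \<in> V" "V \<subseteq> frame x" and w: "hol_vec V w"
    and pw: "\<And>z. z \<in> V \<Longrightarrow> p_loc x z *v w z = 0"
  obtains V' \<tau> where "opn V'" "x \<in> V'" "V' \<subseteq> V" "\<tau> \<in> hol X V'"
    "\<forall>z\<in>V'. \<forall>k. w z $ k = \<tau> z * \<iota>_loc x z $ k $ 1"
proof -
  let ?s = "\<lambda>z. if z \<in> V then matrix_inv (triv E x z) *v w z else 0"
  have s: "?s \<in> sections X E V"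
    by (rule sections_frame[OF E x V(1) _ w]) (use V in \<open>auto simp: frame_def\<close>)
  have "p z *v ?s z = 0" if z: "z \<in> V" for z
  proof -
    have inv: "invertible (triv L2 x z)" using invertible_frame[OF x] z V(3) by auto
    have "triv L2 x z *v (p z *v ?s z) = 0"
      using pw[OF z] z by (simp add: p_loc_def matrix_vector_mul_assoc matrix_mul_assoc)
    then show ?thesis using matrix_inv_cancel_mult(6)[OF inv] by (metis matrix_vector_mult_0_right)
  qed
  then have "\<forall>x\<in>V. \<exists>V'. opn V' \<and> x \<in> V' \<and> V' \<subseteq> V \<and> (\<exists>t\<in>sections X L1 V'. \<forall>z\<in>V'. ?s z = \<iota> z *v t z)"
    by (intro serre_exact[OF V(1) s, THEN iffD1] ballI)
  from bspec[OF this V(2)]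
  have "\<exists>V'. opn V' \<and> x \<in> V' \<and> V' \<subseteq> V \<and> (\<exists>t\<in>sections X L1 V'. \<forall>z\<in>V'. ?s z = \<iota> z *v t z)" .
  then obtain V' t where V': "opn V'" "x \<in> V'" "V' \<subseteq> V" and t: "t \<in> sections X L1 V'"
    and st: "\<forall>z\<in>V'. ?s z = \<iota> z *v t z" by blast
  have "V' \<inter> chart L1 x = V'" using V' V by (auto simp: frame_def)
  then have hol: "(\<lambda>z. (triv L1 x z *v t z) $ 1) \<in> hol X V'"
    using sections_coords[OF t x] by (simp add: hol_vec_def)
  show thesis
  proof (rule that[OF V' hol], intro ballI allI)
    fix z k assume z: "z \<in> V'"
    note inv = invertible_frame[OF x, of z]
    have "w z = triv E x z *v ?s z"
      using z V' V inv by (auto simp: matrix_inv_cancel_mult)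
    also have "\<dots> = \<iota>_loc x z *v (triv L1 x z *v t z)"
      using st z V' V inv
      by (auto simp: \<iota>_loc_def matrix_vector_mul_assoc[symmetric] matrix_inv_cancel_mult)
    finally show "w z $ k = (triv L1 x z *v t z) $ 1 * \<iota>_loc x z $ k $ 1"
      by (simp add: matrix_vector_mult_def sum_1 mult.commute)
  qed
qed

text \<open>The Koszul vector \<open>(- p2, p1)\<close> built from the entries of
  \<open>p_loc\<close> is killed by \<open>p_loc\<close>, so near \<open>x\<close> it is a multiple
  of \<open>\<iota>_loc\<close>. A zero of \<open>\<iota>\<close> at \<open>x\<close> would thus be
  a zero of \<open>p\<close>.\<close>

lemma \<iota>_nonzero:
  assumes x: "x \<in> points X" "x \<notin> S"
  shows "\<iota> x \<noteq> 0"
proof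
  assume ix: "\<iota> x = 0"
  note V = opn_frame[OF x(1)] in_frame[OF x(1)]
  let ?w = "\<lambda>z. (vector [- p_loc x z $ 1 $ 2, p_loc x z $ 1 $ 1] :: complex^2)"
  have w: "hol_vec (frame x) ?w"
    using p_loc_hol[OF x(1)] V(1) unfolding hol_vec_def hol_mat_def
    by (auto simp: forall_2 intro: hol_uminus)
  have pw: "p_loc x z *v ?w z = 0" for z
    by (simp add: vec_eq_iff matrix_vector_mult_def sum_2)
  obtain V' \<tau> where "opn V'" and xV': "x \<in> V'" and "V' \<subseteq> frame x" "\<tau> \<in> hol X V'"
    and eq: "\<forall>z\<in>V'. \<forall>k. ?w z $ k = \<tau> z * \<iota>_loc x z $ k $ 1"
    by (rule lift_to_L1[OF x(1) V order_refl w pw])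
  have "\<iota>_loc x x = 0" using ix by (simp add: \<iota>_loc_def)
  then have "?w x $ k = 0" for k using eq xV' by simp
  from this[of 1] this[of 2] have "p_loc x x = 0" by (simp add: vec_eq_iff forall_2)
  then show False using p_loc_eq_0[OF x(1) V(2)] p_nonzero[OF x] by simp
qed

lemma p_loc_\<iota>_loc:
  assumes "x \<in> points X" "z \<in> frame x"
  shows "p_loc x z ** \<iota>_loc x z = 0"
proof -
  have "z \<in> points X" by (rule opn_points[OF opn_frame[OF assms(1)] assms(2)])
  then show ?thesis
    using p_\<iota>[of z]
    by (simp only: p_loc_def \<iota>_loc_def matrix_mul_assoc[symmetric]
        matrix_inv_cancel_mult(4)[OF invertible_frame(1)[OF assms]])
      (simp add: matrix_mul_assoc)
qed

end

section \<open>Nilpotency of twisted endomorphisms\<close>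

lemma sum_UNIV_prod: "(\<Sum>k\<in>(UNIV :: ('b::finite \<times> 'c::finite) set). f k) = (\<Sum>i\<in>UNIV. \<Sum>j\<in>UNIV. f (i, j))"
  unfolding sum.cartesian_product UNIV_Times_UNIV by simp

lemma mult_scaled:
  fixes K :: "complex^'n::finite^'m::finite" and P :: "complex^'m^'k" and N :: "complex^'l^'n"
  shows "(P ** (\<chi> i j. h * K $ i $ j) ** N) $ i $ j = h * (P ** K ** N) $ i $ j"
  by (simp add: matrix_matrix_mult_def sum_distrib_left sum_distrib_right ac_simps)

text \<open>For trace 0 the characteristic polynomial of \<open>M\<close> at \<open>t\<close> is
  \<open>t^2 + det M\<close>, and \<open>v\<close> is an eigenvector for \<open>t\<close>.\<close>

lemma eigenvalue_trace_free:
  fixes M :: "complex^2^2" and v :: "complex^1^2"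
  assumes "trace M = 0" "v \<noteq> 0" "\<forall>k. (M ** v) $ k $ 1 = t * v $ k $ 1"
  shows "t\<^sup>2 + det M = 0"
proof -
  have e1: "M $ 1 $ 1 * v $ 1 $ 1 + M $ 1 $ 2 * v $ 2 $ 1 = t * v $ 1 $ 1"
    and e2: "M $ 2 $ 1 * v $ 1 $ 1 + M $ 2 $ 2 * v $ 2 $ 1 = t * v $ 2 $ 1"
    using assms(3) by (simp_all add: matrix_matrix_mult_def sum_2 forall_2)
  have tr: "M $ 2 $ 2 = - M $ 1 $ 1"
    using assms(1) by (simp add: trace_def sum_2 eq_neg_iff_add_eq_0 add.commute)
  have "(t\<^sup>2 + det M) * v $ 1 $ 1 = 0"
    using e1 e2 unfolding det_2 tr by algebra
  moreover have "(t\<^sup>2 + det M) * v $ 2 $ 1 = 0"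
    using e1 e2 unfolding det_2 tr by algebra
  moreover have "v $ 1 $ 1 \<noteq> 0 \<or> v $ 2 $ 1 \<noteq> 0"
    using assms(2) by (auto simp: vec_eq_iff forall_2)
  ultimately show ?thesis by auto
qed

text \<open>The covectors killing a nonzero vector of the plane form a line, so \<open>P\<close> is
  a nonzero multiple of \<open>n\<close>.\<close>

lemma annihilators_proportional:
  fixes P :: "complex^2^1" and v :: "complex^1^2" and n :: "complex^2"
  assumes "P \<noteq> 0" "v \<noteq> 0" "P ** v = 0" "n $ 1 * v $ 1 $ 1 + n $ 2 * v $ 2 $ 1 = 0" "n $ j \<noteq> 0"
  shows "P $ 1 $ j \<noteq> 0"
proof -
  have Pv: "P $ 1 $ 1 * v $ 1 $ 1 + P $ 1 $ 2 * v $ 2 $ 1 = 0"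
    using assms(3) by (simp add: vec_eq_iff matrix_matrix_mult_def sum_2)
  have v: "v $ 1 $ 1 \<noteq> 0 \<or> v $ 2 $ 1 \<noteq> 0" and P: "P $ 1 $ 1 \<noteq> 0 \<or> P $ 1 $ 2 \<noteq> 0"
    using assms(1,2) by (auto simp: vec_eq_iff forall_2)
  show ?thesis
    using assms(4,5) Pv v P exhaust_2[of j] by auto
qed

text \<open>As \<open>P\<close> kills \<open>M v\<close>, this vector is a multiple of
  \<open>v\<close>, and nilpotency makes the eigenvalue 0. So \<open>M\<close> kills
  \<open>v\<close> and factors through \<open>P\<close>; its image lies in its kernel, so it is
  spanned by \<open>v\<close> unless \<open>M\<close> is 0.\<close>

lemma nilpotent_rank_one:
  fixes P :: "complex^2^1" and v :: "complex^1^2" and M :: "complex^2^2"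
  assumes "P \<noteq> 0" "v \<noteq> 0" "P ** v = 0" "P ** M ** v = 0" "trace M = 0" "det M = 0"
  shows "\<exists>c. \<forall>k j. M $ k $ j = v $ k $ 1 * c * P $ 1 $ j"
proof -
  define i1 i2 P1 P2 a b c where "i1 = v $ 1 $ 1" and "i2 = v $ 2 $ 1" and "P1 = P $ 1 $ 1" and "P2 = P $ 1 $ 2"
    and "a = M $ 1 $ 1" and "b = M $ 1 $ 2" and "c = M $ 2 $ 1"
  note defs = this
  have tr: "M $ 2 $ 2 = - a"
    using assms(5) by (simp add: a_def trace_def sum_2 eq_neg_iff_add_eq_0 add.commute)
  have det: "a * a + b * c = 0"
    using assms(6) unfolding det_2 tr a_def b_def c_def by algebra
  have Pv: "P1 * i1 + P2 * i2 = 0"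
    using assms(3) by (simp add: vec_eq_iff matrix_matrix_mult_def sum_2 defs)
  have PMv: "(P1 * a + P2 * c) * i1 + (P1 * b - P2 * a) * i2 = 0"
    using assms(4) tr by (simp add: vec_eq_iff matrix_matrix_mult_def sum_2 defs)
  have v: "i1 \<noteq> 0 \<or> i2 \<noteq> 0" and P: "P1 \<noteq> 0 \<or> P2 \<noteq> 0"
    using assms(1,2) by (auto simp: vec_eq_iff forall_2 defs)
  have "\<exists>t. a = i1 * t * P1 \<and> b = i1 * t * P2 \<and> c = i2 * t * P1 \<and> - a = i2 * t * P2"
  proof (cases "i1 = 0")
    case True
    then have "i2 \<noteq> 0" "P2 = 0" "P1 \<noteq> 0" using v P Pv by auto
    then have "b = 0" using PMv True by auto
    then have "a = 0" using det by auto
    show ?thesis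
      by (rule exI[of _ "c / (i2 * P1)"]) (use True \<open>i2 \<noteq> 0\<close> \<open>P2 = 0\<close> \<open>P1 \<noteq> 0\<close> \<open>a = 0\<close> \<open>b = 0\<close> in auto)
  next
    case False
    then have P2: "P2 \<noteq> 0" using Pv P by auto
    have P1: "P1 = - P2 * i2 / i1" using Pv False by (simp add: field_simps eq_neg_iff_add_eq_0)
    \<comment> \<open>\<open>PMv\<close> with \<open>P1\<close> eliminated by means of
      \<open>Pv\<close>.\<close>
    have "P2 * (c * i1\<^sup>2 - (2 * a * i1 * i2 + b * i2\<^sup>2)) = 0"
      using PMv Pv by algebra
    then have rel: "c * i1\<^sup>2 = 2 * a * i1 * i2 + b * i2\<^sup>2" using P2 by (simp only: mult_eq_0_iff) simp
    \<comment> \<open>By \<open>rel\<close> the square equals \<open>i1^2 * (a * a + b * c)\<close>,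
      and the second factor is zero by \<open>det\<close>. The quantity squared is the first entry
      of \<open>M v\<close>.\<close>
    have "(a * i1 + b * i2)\<^sup>2 = 0"
      using rel det by algebra
    then have "a * i1 + b * i2 = 0" by simp
    then have a: "a = - b * i2 / i1" using False by (simp add: field_simps eq_neg_iff_add_eq_0)
    have c: "c = - b * i2\<^sup>2 / i1\<^sup>2"
      using rel False unfolding a by (simp add: field_simps power2_eq_square)
    show ?thesis
      \<comment> \<open>The value is forced by the entry \<open>b = i1 * t * P2\<close>.\<close>
      by (rule exI[of _ "b / (i1 * P2)"]) (use False P2 in \<open>simp add: P1 a c field_simps power2_eq_square\<close>)
  qed
  then show ?thesis using tr by (auto simp: forall_2 defs)
qed

text \<open>Cayley-Hamilton with both coefficients equal to zero.\<close>

lemma trace_free_singular_square: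
  fixes M :: "complex^2^2"
  assumes "trace M = 0" "det M = 0"
  shows "M ** M = 0"
proof -
  have tr: "M $ 2 $ 2 = - M $ 1 $ 1"
    using assms(1) by (simp add: trace_def sum_2 eq_neg_iff_add_eq_0 add.commute)
  have d: "M $ 1 $ 1 * M $ 1 $ 1 + M $ 1 $ 2 * M $ 2 $ 1 = 0"
    using assms(2) unfolding det_2 tr by algebra
  then have "M $ 2 $ 1 * M $ 1 $ 2 + M $ 1 $ 1 * M $ 1 $ 1 = 0" by algebra
  with d show ?thesis
    by (simp add: vec_eq_iff forall_2 matrix_matrix_mult_def sum_2 tr eq_neg_iff_add_eq_0)
qed

text \<open>The explicit map runs from \<open>W\<close> to \<open>V\<close>, while the isomorphism
  is wanted from \<open>V\<close> to \<open>W\<close>. Closure of \<open>W\<close> under the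
  operations is needed to recognise sums and multiples as values of the inverse.\<close>

lemma linear_isomorphic_inverse:
  assumes R: "bij_betw R W V"
    and W_add: "\<And>s t. s \<in> W \<Longrightarrow> t \<in> W \<Longrightarrow> (\<lambda>z. s z + t z) \<in> W"
    and W_scale: "\<And>c s. s \<in> W \<Longrightarrow> (\<lambda>z. c *s s z) \<in> W"
    and add: "\<And>s t. R (\<lambda>z. s z + t z) = (\<lambda>z. R s z + R t z)"
    and scale: "\<And>c s. R (\<lambda>z. c *s s z) = (\<lambda>z. c *s R s z)"
  shows "linear_isomorphic V W"
  unfolding linear_isomorphic_def
proof (intro exI conjI ballI allI)
  let ?T = "the_inv_into W R"
  have inj: "inj_on R W" using R bij_betw_def by blast
  have T: "?T u \<in> W \<and> R (?T u) = u" if "u \<in> V" for u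
    using that R f_the_inv_into_f_bij_betw[OF R] the_inv_into_into[OF inj] bij_betw_imp_surj_on[OF R] by auto
  have T_eq: "?T u = w" if "w \<in> W" "R w = u" for u w
    using the_inv_into_f_eq[OF inj that(2,1)] .
  show "bij_betw ?T V W" by (rule bij_betw_the_inv_into[OF R])
  show "?T (\<lambda>z. s z + t z) = (\<lambda>z. ?T s z + ?T t z)" if "s \<in> V" "t \<in> V" for s t
    using T[OF that(1)] T[OF that(2)] by (intro T_eq W_add) (simp_all add: add)
  show "?T (\<lambda>z. c *s s z) = (\<lambda>z. c *s ?T s z)" if "s \<in> V" for c s
    using T[OF that] by (intro T_eq W_scale) (simp_all add: scale)
qed

context hopf_quotient
begin

lemma line_transition_hol:
  assumes L: "line_bundle X L" and x: "x \<in> points X" and y: "y \<in> points X"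
  shows "(\<lambda>z. triv L x z $ 1 $ 1 / triv L y z $ 1 $ 1) \<in> hol X (chart L x \<inter> chart L y)"
proof (rule hol_cong)
  show "opn (chart L x \<inter> chart L y)" using chartD(1)[OF L] x y by blast
  show "(\<lambda>z. (triv L x z ** matrix_inv (triv L y z)) $ 1 $ 1) \<in> hol X (chart L x \<inter> chart L y)"
    using transition_hol[OF assms] unfolding hol_mat_def by blast
  show "(triv L x z ** matrix_inv (triv L y z)) $ 1 $ 1 = triv L x z $ 1 $ 1 / triv L y z $ 1 $ 1"
    if "z \<in> chart L x \<inter> chart L y" for z
  proof -
    have "invertible (triv L y z)" using chartD(3)[OF L y] that by blast
    then show ?thesis by (simp only: mult_1_1 invertible_1_1(2) divide_inverse)
  qed
qed

end

section \<open>Twisted endomorphisms in local frames\<close>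

context serre_extension
begin

abbreviation ratio :: "('a, 1) vbundle \<Rightarrow> 'a \<Rightarrow> 'a \<Rightarrow> 'a \<Rightarrow> complex" where
  "ratio L x y z \<equiv> triv L x z $ 1 $ 1 / triv L y z $ 1 $ 1"

lemma ratio_hol:
  assumes "x \<in> points X" "y \<in> points X" "opn V"
  shows "V \<subseteq> chart L1 x \<inter> chart L1 y \<Longrightarrow> ratio L1 x y \<in> hol X V"
    "V \<subseteq> chart L2 x \<inter> chart L2 y \<Longrightarrow> ratio L2 x y \<in> hol X V"
    "V \<subseteq> chart H x \<inter> chart H y \<Longrightarrow> ratio H x y \<in> hol X V"
proof -
  have chart: "opn (chart L x \<inter> chart L y)" if "line_bundle X L" for L :: "('a, 1) vbundle"
    by (intro openin_Int chartD(1)[OF that] assms)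
  note rule = hol_subset[OF chart line_transition_hol[OF _ assms(1,2)] assms(3)]
  show "V \<subseteq> chart L1 x \<inter> chart L1 y \<Longrightarrow> ratio L1 x y \<in> hol X V"
    "V \<subseteq> chart L2 x \<inter> chart L2 y \<Longrightarrow> ratio L2 x y \<in> hol X V"
    "V \<subseteq> chart H x \<inter> chart H y \<Longrightarrow> ratio H x y \<in> hol X V"
    by (rule rule[OF L1 L1] rule[OF L2 L2] rule[OF H H], assumption)+
qed

lemma line_coords_nonzero:
  assumes "x \<in> points X"
  shows "z \<in> chart L1 x \<Longrightarrow> triv L1 x z $ 1 $ 1 \<noteq> 0" "z \<in> chart L2 x \<Longrightarrow> triv L2 x z $ 1 $ 1 \<noteq> 0"
    "z \<in> chart H x \<Longrightarrow> triv H x z $ 1 $ 1 \<noteq> 0"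
  using invertible_1_1(1)[OF chartD(3)[OF L1 assms]] invertible_1_1(1)[OF chartD(3)[OF L2 assms]]
    invertible_1_1(1)[OF chartD(3)[OF H assms]] by auto

definition endo_loc :: "('a \<Rightarrow> complex^((2 \<times> 2) \<times> 1)) \<Rightarrow> 'a \<Rightarrow> 'a \<Rightarrow> complex^2^2" where
  "endo_loc \<phi> x z = (\<chi> i j. triv H x z $ 1 $ 1 *
     (triv E x z ** twisted_endo (\<phi> z) ** matrix_inv (triv E x z)) $ i $ j)"

lemma triv_End:
  "(triv (tensor (tensor E (dual E)) H) x z *v \<phi> z) $ ((i, j), 1) = endo_loc \<phi> x z $ i $ j"
proof -
  have entry: "triv (tensor (tensor E (dual E)) H) x z $ ((i, j), 1) $ ((k, l), 1) =
      triv E x z $ i $ k * matrix_inv (triv E x z) $ l $ j * triv H x z $ 1 $ 1" for k l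
    by (simp add: tensor_def dual_def transpose_def)
  have "(triv (tensor (tensor E (dual E)) H) x z *v \<phi> z) $ ((i, j), 1) =
      (\<Sum>k\<in>UNIV. \<Sum>l\<in>UNIV. triv E x z $ i $ k * matrix_inv (triv E x z) $ l $ j * triv H x z $ 1 $ 1 * \<phi> z $ ((k, l), 1))"
    unfolding matrix_vector_mult_def vec_lambda_beta sum_UNIV_prod sum_1 entry ..
  then show ?thesis
    unfolding endo_loc_def matrix_matrix_mult_def vec_lambda_beta twisted_endo_def sum_2 by algebra
qed

lemma chart_End: "chart (tensor (tensor E (dual E)) H) x = chart E x \<inter> chart H x"
  by (simp add: tensor_def dual_def)

lemma H0_End0_iff:
  "\<phi> \<in> H0_End0 X E H \<longleftrightarrow> (\<forall>z. z \<notin> points X \<longrightarrow> \<phi> z = 0) \<and>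
     (\<forall>x\<in>points X. hol_mat (points X \<inter> (chart E x \<inter> chart H x)) (endo_loc \<phi> x)) \<and>
     (\<forall>z\<in>points X. trace (twisted_endo (\<phi> z)) = 0)"
proof -
  have "k = ((fst (fst k), snd (fst k)), 1)" for k :: "(2 \<times> 2) \<times> 1"
    by (simp add: prod_eq_iff)
  then have all: "(\<forall>k. Q k) \<longleftrightarrow> (\<forall>i j. Q ((i, j), 1))" for Q :: "(2 \<times> 2) \<times> 1 \<Rightarrow> bool"
    by metis
  show ?thesis
    unfolding H0_End0_def H0_def sections_def chart_End hol_mat_def all triv_End mem_Collect_eq conj_assoc ..
qed

lemmas H0_End0D = H0_End0_iff[THEN iffD1, THEN conjunct1] H0_End0_iff[THEN iffD1, THEN conjunct2, THEN conjunct1]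
  H0_End0_iff[THEN iffD1, THEN conjunct2, THEN conjunct2]

lemma points_Int: "opn U \<Longrightarrow> points X \<inter> U = U"
  by (rule Int_absorb1[OF openin_subset])

lemma opn_chart_EH: "x \<in> points X \<Longrightarrow> opn (chart E x \<inter> chart H x)"
  by (intro openin_Int charts)

lemma endo_loc_hol:
  assumes "\<phi> \<in> H0_End0 X E H" "x \<in> points X"
  shows "hol_mat (frame x) (endo_loc \<phi> x)"
proof (rule hol_mat_subset[OF opn_chart_EH[OF assms(2)] _ opn_frame[OF assms(2)]])
  show "hol_mat (chart E x \<inter> chart H x) (endo_loc \<phi> x)"
    using H0_End0D(2)[OF assms(1), THEN bspec, OF assms(2)]
    unfolding points_Int[OF opn_chart_EH[OF assms(2)]] .
qed (use assms in \<open>auto simp: frame_def\<close>)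

lemma endo_loc_transition:
  assumes x: "x \<in> points X" "z \<in> chart E x" "z \<in> chart H x" and y: "y \<in> points X" "z \<in> frame y"
  shows "endo_loc \<phi> x z $ i $ j = ratio H x y z *
    ((triv E x z ** matrix_inv (triv E y z)) ** endo_loc \<phi> y z ** (triv E y z ** matrix_inv (triv E x z))) $ i $ j"
proof -
  have h: "triv H y z $ 1 $ 1 \<noteq> 0" using line_coords_nonzero(3)[OF y(1)] y(2) by (auto simp: frame_def)
  note inv = invertible_frame(1)[OF y]
  let ?A = "triv E x z" and ?B = "triv E y z" and ?F = "twisted_endo (\<phi> z)"
  have scale: "(M ** endo_loc \<phi> y z ** N) $ i $ j = triv H y z $ 1 $ 1 * (M ** (?B ** ?F ** matrix_inv ?B) ** N) $ i $ j"
    for M N :: "complex^2^2"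
    unfolding endo_loc_def by (rule mult_scaled)
  have "?A ** matrix_inv ?B ** (?B ** ?F ** matrix_inv ?B) ** (?B ** matrix_inv ?A) = ?A ** ?F ** matrix_inv ?A"
    by (simp only: matrix_mul_assoc[symmetric] matrix_inv_cancel_mult(4)[OF inv])
  then show ?thesis
    unfolding scale using h by (simp add: endo_loc_def)
qed

text \<open>The charts of the endomorphism bundle may be larger than \<open>frame x\<close>.
  Holomorphy on the rest of such a chart is imported from the frames at its other points by
  \<open>endo_loc_transition\<close>.\<close>

lemma H0_End0I:
  assumes out: "\<And>z. z \<notin> points X \<Longrightarrow> \<phi> z = 0" and tr: "\<And>z. z \<in> points X \<Longrightarrow> trace (twisted_endo (\<phi> z)) = 0"
    and hol: "\<And>x. x \<in> points X \<Longrightarrow> hol_mat (frame x) (endo_loc \<phi> x)"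
  shows "\<phi> \<in> H0_End0 X E H"
  unfolding H0_End0_iff
proof (intro conjI ballI allI impI out tr)
  fix x assume x: "x \<in> points X"
  let ?W = "chart E x \<inter> chart H x"
  have W: "opn ?W" by (rule opn_chart_EH[OF x])
  have "(\<lambda>z. endo_loc \<phi> x z $ i $ j) \<in> hol X ?W" for i j
  proof (rule hol_local[OF W])
    fix y assume "y \<in> ?W"
    then have y: "y \<in> points X" using opn_points[OF W] by blast
    let ?V = "?W \<inter> frame y"
    have V: "opn ?V" using W opn_frame[OF y] by blast
    have "hol_mat ?V (\<lambda>z. (triv E x z ** matrix_inv (triv E y z)) ** endo_loc \<phi> y z ** (triv E y z ** matrix_inv (triv E x z)))"
      by (intro hol_mat_mult[OF V]
          hol_mat_subset[OF _ transition_hol[OF E x y] V] hol_mat_subset[OF _ transition_hol[OF E y x] V]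
          hol_mat_subset[OF opn_frame[OF y] hol[OF y] V])
        (use charts(1) x y in \<open>auto simp: frame_def\<close>)
    then have "(\<lambda>z. ratio H x y z * ((triv E x z ** matrix_inv (triv E y z)) ** endo_loc \<phi> y z **
        (triv E y z ** matrix_inv (triv E x z))) $ i $ j) \<in> hol X ?V"
      unfolding hol_mat_def by (intro hol_mult[OF V] ratio_hol(3)[OF x y V]) (auto simp: frame_def)
    then have "(\<lambda>z. endo_loc \<phi> x z $ i $ j) \<in> hol X ?V"
      by (rule hol_cong[OF V]) (use endo_loc_transition[OF x _ _ y] in auto)
    then show "\<exists>V. opn V \<and> y \<in> V \<and> (\<lambda>z. endo_loc \<phi> x z $ i $ j) \<in> hol X (?W \<inter> V)"
      using opn_frame[OF y] in_frame[OF y] by blast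
  qed
  then show "hol_mat (points X \<inter> ?W) (endo_loc \<phi> x)"
    unfolding points_Int[OF W] hol_mat_def by blast
qed

lemma trace_endo_loc:
  assumes "\<phi> \<in> H0_End0 X E H" "x \<in> points X" "z \<in> frame x"
  shows "trace (endo_loc \<phi> x z) = 0"
proof -
  have "z \<in> points X" by (rule opn_points[OF opn_frame[OF assms(2)] assms(3)])
  then have "trace (triv E x z ** twisted_endo (\<phi> z) ** matrix_inv (triv E x z)) = 0"
    using H0_End0D(3)[OF assms(1)] trace_conj[OF invertible_frame(1)[OF assms(2,3)]] by simp
  moreover have "trace (endo_loc \<phi> x z) = triv H x z $ 1 $ 1 *
      trace (triv E x z ** twisted_endo (\<phi> z) ** matrix_inv (triv E x z))"
    by (simp add: trace_def endo_loc_def sum_2 distrib_left)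
  ultimately show ?thesis by simp
qed

text \<open>A conjugation leaves the determinant alone and a scalar factor enters squared, so
  \<open>det \<phi>\<close> is a section of the square of \<open>H\<close>.\<close>

lemma det_endo_loc:
  assumes "x \<in> points X" "z \<in> frame x"
  shows "det (endo_loc \<phi> x z) = (triv H x z $ 1 $ 1)\<^sup>2 * det (twisted_endo (\<phi> z))"
proof -
  have "det (endo_loc \<phi> x z) = (triv H x z $ 1 $ 1)\<^sup>2 *
      det (triv E x z ** twisted_endo (\<phi> z) ** matrix_inv (triv E x z))"
    unfolding det_2 endo_loc_def vec_lambda_beta by algebra
  then show ?thesis by (simp only: det_conj[OF invertible_frame(1)[OF assms]])
qed

section \<open>Vanishing of \<open>p \<phi> \<iota>\<close> and of the determinant\<close>

text \<open>Exhibits the scalar \<open>p \<phi> \<iota>\<close> as a section of the tensor product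
  of \<open>L2\<close>, \<open>H\<close> and the dual of \<open>L1\<close>; the factor in front of
  it on the right is the local frame.\<close>

lemma p_endo_\<iota>_loc:
  assumes "x \<in> points X" "z \<in> frame x"
  shows "(p_loc x z ** endo_loc \<phi> x z ** \<iota>_loc x z) $ 1 $ 1 =
    triv L2 x z $ 1 $ 1 * triv H x z $ 1 $ 1 / triv L1 x z $ 1 $ 1 * (p z ** twisted_endo (\<phi> z) ** \<iota> z) $ 1 $ 1"
proof -
  note inv = invertible_frame[OF assms]
  let ?A = "triv E x z" and ?F = "twisted_endo (\<phi> z)"
  have "(p_loc x z ** endo_loc \<phi> x z ** \<iota>_loc x z) $ 1 $ 1 =
      triv H x z $ 1 $ 1 * (p_loc x z ** (?A ** ?F ** matrix_inv ?A) ** \<iota>_loc x z) $ 1 $ 1"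
    unfolding endo_loc_def by (rule mult_scaled)
  also have "p_loc x z ** (?A ** ?F ** matrix_inv ?A) ** \<iota>_loc x z =
      triv L2 x z ** ((p z ** ?F ** \<iota> z) ** matrix_inv (triv L1 x z))"
    by (simp only: p_loc_def \<iota>_loc_def matrix_mul_assoc[symmetric] matrix_inv_cancel_mult(4)[OF inv(1)])
  finally show ?thesis
    using invertible_1_1[OF inv(2)] by (simp add: mult_1_1 divide_inverse)
qed

lemma p_endo_\<iota>:
  assumes \<phi>: "\<phi> \<in> H0_End0 X E H" and x: "x \<in> points X"
  shows "p x ** twisted_endo (\<phi> x) ** \<iota> x = 0"
proof -
  define \<theta> where "\<theta> = (\<lambda>x z. triv L2 x z $ 1 $ 1 * triv H x z $ 1 $ 1 / triv L1 x z $ 1 $ 1)"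
  have "(p x ** twisted_endo (\<phi> x) ** \<iota> x) $ 1 $ 1 = 0"
  proof (rule section_vanishing_on_nondivisor[of frame \<theta>, OF _ _ _ _ S_points _ _ x])
    show "\<not> contained_in_divisor X S" using not_div by (simp add: S_def)
    show "opn (frame x) \<and> x \<in> frame x" if "x \<in> points X" for x
      using that opn_frame in_frame by blast
    show "\<theta> x z \<noteq> 0" if "x \<in> points X" "z \<in> frame x" for x z
      using that line_coords_nonzero[OF that(1)] by (simp add: \<theta>_def frame_def)
    show "(p z ** twisted_endo (\<phi> z) ** \<iota> z) $ 1 $ 1 = 0" if "z \<in> S" for z
      using p_zero[OF that] by simp
  next
    fix x assume x: "x \<in> points X"
    note V = opn_frame[OF x]
    have "hol_mat (frame x) (\<lambda>z. p_loc x z ** endo_loc \<phi> x z ** \<iota>_loc x z)"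
      by (intro hol_mat_mult[OF V] p_loc_hol[OF x] \<iota>_loc_hol[OF x] endo_loc_hol[OF \<phi> x])
    then have "(\<lambda>z. (p_loc x z ** endo_loc \<phi> x z ** \<iota>_loc x z) $ 1 $ 1) \<in> hol X (frame x)"
      unfolding hol_mat_def by blast
    then show "(\<lambda>z. \<theta> x z * (p z ** twisted_endo (\<phi> z) ** \<iota> z) $ 1 $ 1) \<in> hol X (frame x)"
      by (rule hol_cong[OF V]) (simp add: p_endo_\<iota>_loc[OF x] \<theta>_def)
  next
    fix x y assume x: "x \<in> points X" and y: "y \<in> points X"
    have V: "opn (frame x \<inter> frame y)" using opn_frame x y by blast
    have "(\<lambda>z. ratio L2 x y z * ratio H x y z * ratio L1 y x z) \<in> hol X (frame x \<inter> frame y)"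
      by (intro hol_mult[OF V] ratio_hol[OF x y V] ratio_hol[OF y x V]) (auto simp: frame_def)
    then show "(\<lambda>z. \<theta> x z / \<theta> y z) \<in> hol X (frame x \<inter> frame y)"
      by (rule hol_cong[OF V]) (simp add: \<theta>_def)
  qed
  then show ?thesis by (simp add: matrix_1_1_eq_0)
qed

text \<open>Here \<open>N = \<phi> - \<tau>\<close> kills \<open>\<iota>\<close>, and \<open>p\<close> is the multiple of the \<open>k\<close>-th row of \<open>N\<close> by \<open>p\<^sub>j / N\<^sub>k\<^sub>j\<close>.\<close>

lemma det_endo_zero_at_S:
  assumes \<phi>: "\<phi> \<in> H0_End0 X E H" and xS: "x \<in> S"
  shows "det (endo_loc \<phi> x x) = 0"
proof -
  have x: "x \<in> points X" using xS S_points by blast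
  let ?M = "endo_loc \<phi> x"
  have M: "hol_mat (frame x) ?M" by (rule endo_loc_hol[OF \<phi> x])
  have "hol_mat (frame x) (\<lambda>z. ?M z ** \<iota>_loc x z)"
    by (rule hol_mat_mult[OF opn_frame[OF x] M \<iota>_loc_hol[OF x]])
  then have w: "hol_vec (frame x) (\<lambda>z. column 1 (?M z ** \<iota>_loc x z))"
    by (simp add: hol_mat_def hol_vec_def column_def)
  have pw: "p_loc x z *v column 1 (?M z ** \<iota>_loc x z) = 0" if z: "z \<in> frame x" for z
  proof -
    have "z \<in> points X" by (rule opn_points[OF opn_frame[OF x] z])
    then have "(p_loc x z ** ?M z ** \<iota>_loc x z) $ 1 $ 1 = 0"
      using p_endo_\<iota>_loc[OF x z, of \<phi>] p_endo_\<iota>[OF \<phi>] by simp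
    then have "(p_loc x z ** (?M z ** \<iota>_loc x z)) $ 1 $ 1 = 0" by (simp add: matrix_mul_assoc)
    then show ?thesis
      by (simp add: vec_eq_iff matrix_vector_mult_def column_def matrix_matrix_mult_def)
  qed
  obtain W \<tau> where W: "opn W" "x \<in> W" "W \<subseteq> frame x" "\<tau> \<in> hol X W"
    and eig: "\<forall>z\<in>W. \<forall>k. column 1 (?M z ** \<iota>_loc x z) $ k = \<tau> z * \<iota>_loc x z $ k $ 1"
    by (rule lift_to_L1[OF x opn_frame[OF x] in_frame[OF x] order_refl w pw])
  \<comment> \<open>With \<open>x\<close> as the only point of \<open>S\<close> in \<open>V\<close>,
    both \<open>p_loc\<close> and \<open>\<iota>_loc\<close> are nonzero on \<open>V\<close> off
    \<open>x\<close>.\<close>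
  obtain V where V: "opn V" "x \<in> V" "V \<subseteq> W" "V \<inter> S = {x}"
    by (rule isolating[OF xS W(1,2)])
  have Vf: "V \<subseteq> frame x" using V W by blast
  have MV: "hol_mat V ?M" by (rule hol_mat_subset[OF opn_frame[OF x] M V(1) Vf])
  then have Mij: "(\<lambda>z. ?M z $ i $ j) \<in> hol X V" for i j by (simp add: hol_mat_def)
  have \<tau>: "\<tau> \<in> hol X V" by (rule hol_subset[OF W(1,4) V(1,3)])
  have ne: "p_loc x z \<noteq> 0" "\<iota>_loc x z \<noteq> 0" if "z \<in> V" "z \<noteq> x" for z
  proof -
    have "z \<in> frame x" "z \<in> points X" "z \<notin> S"
      using that V Vf opn_points[OF V(1)] by auto
    then show "p_loc x z \<noteq> 0" "\<iota>_loc x z \<noteq> 0"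
      using p_nonzero \<iota>_nonzero p_loc_eq_0[OF x] \<iota>_loc_eq_0[OF x] by auto
  qed
  \<comment> \<open>At \<open>x\<close> itself \<open>\<iota>_loc\<close> may vanish and then gives
    no eigenvector, so the relation is proved off \<open>x\<close> and carried over.\<close>
  have det_\<tau>: "(\<tau> x)\<^sup>2 + det (?M x) = 0"
  proof (rule hol_eq_zero_at[OF V(1,2), of "\<lambda>z. (\<tau> z)\<^sup>2 + det (?M z)"])
    show "(\<lambda>z. (\<tau> z)\<^sup>2 + det (?M z)) \<in> hol X V"
      unfolding power2_eq_square det_2
      by (intro hol_add[OF V(1)] hol_diff[OF V(1)] hol_mult[OF V(1)] \<tau> Mij)
    show "(\<tau> z)\<^sup>2 + det (?M z) = 0" if z: "z \<in> V" "z \<noteq> x" for z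
      by (rule eigenvalue_trace_free[OF trace_endo_loc[OF \<phi> x] ne(2)[OF z]])
        (use z Vf V(3) eig in \<open>auto simp: column_def\<close>)
  qed
  have "\<tau> x = 0"
  proof (rule ccontr)
    assume \<tau>x: "\<tau> x \<noteq> 0"
    define N :: "'a \<Rightarrow> complex^2^2" where "N = (\<lambda>z. \<chi> k j. ?M z $ k $ j - (if k = j then \<tau> z else 0))"
    have N: "(\<lambda>z. N z $ k $ j) \<in> hol X V" for k j
      unfolding N_def by (cases "k = j") (use Mij \<tau> in \<open>auto intro: hol_diff[OF V(1)]\<close>)
    \<comment> \<open>If \<open>N x\<close> were zero, both diagonal entries of the trace-free
      matrix would equal \<open>\<tau> x\<close>, which is assumed nonzero.\<close>
    have "\<exists>k j. N x $ k $ j \<noteq> 0"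
    proof (rule ccontr)
      assume "\<not> ?thesis"
      then have "?M x $ 1 $ 1 = \<tau> x" "?M x $ 2 $ 2 = \<tau> x"
        by (auto simp: N_def dest: spec[of _ 1] spec[of _ 2])
      moreover have "?M x $ 1 $ 1 + ?M x $ 2 $ 2 = 0"
        using trace_endo_loc[OF \<phi> x in_frame[OF x]] by (simp add: trace_def sum_2)
      ultimately show False using \<tau>x by simp
    qed
    then obtain k j where kj: "N x $ k $ j \<noteq> 0" by blast
    define Q where "Q = {z \<in> V. N z $ k $ j \<noteq> 0}"
    have Q: "opn Q" "x \<in> Q" "Q \<subseteq> V"
      unfolding Q_def using opn_nonzero[OF V(1) N] kj V(2) by auto
    have "opn (Q - {x})"
    proof -
      have "Q - {x} = Q - S" using Q V xS by blast
      then show ?thesis using opn_minus_S[OF Q(1)] by simp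
    qed
    have v: "(\<lambda>z. p_loc x z $ 1 $ j / N z $ k $ j) \<in> hol X Q"
    proof (rule hol_divide[OF Q(1)])
      show "(\<lambda>z. p_loc x z $ 1 $ j) \<in> hol X Q"
        using hol_mat_subset[OF opn_frame[OF x] p_loc_hol[OF x] Q(1)] Q(3) Vf by (auto simp: hol_mat_def)
      show "(\<lambda>z. N z $ k $ j) \<in> hol X Q" by (rule hol_subset[OF V(1) N Q(1,3)])
    qed (simp add: Q_def)
    have "p_loc x x $ 1 $ j / N x $ k $ j \<noteq> 0"
    proof (rule no_isolated_zero[OF Q(1,2) \<open>opn (Q - {x})\<close> v])
      fix z assume z: "z \<in> Q" "z \<noteq> x"
      then have zV: "z \<in> V" using Q(3) by blast
      have "(?M z ** \<iota>_loc x z) $ k $ 1 = \<tau> z * \<iota>_loc x z $ k $ 1"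
        using eig zV V(3) by (auto simp: column_def)
      then have "N z $ k $ 1 * \<iota>_loc x z $ 1 $ 1 + N z $ k $ 2 * \<iota>_loc x z $ 2 $ 1 = 0"
        using exhaust_2[of k] by (auto simp: N_def matrix_matrix_mult_def sum_2 algebra_simps)
      then have "p_loc x z $ 1 $ j \<noteq> 0"
        using annihilators_proportional[OF ne[OF zV z(2)] p_loc_\<iota>_loc[OF x], of "N z $ k" j] z zV Vf
        by (auto simp: Q_def)
      then show "p_loc x z $ 1 $ j / N z $ k $ j \<noteq> 0" using z(1) by (simp add: Q_def)
    qed
    then show False using p_loc_eq_0[OF x in_frame[OF x]] p_zero[OF xS] by simp
  qed
  then show ?thesis using det_\<tau> by simp
qed

lemma det_endo_zero:
  assumes \<phi>: "\<phi> \<in> H0_End0 X E H" and x: "x \<in> points X"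
  shows "det (twisted_endo (\<phi> x)) = 0"
proof (rule section_vanishing_on_nondivisor[of frame "\<lambda>x z. (triv H x z $ 1 $ 1)\<^sup>2", OF _ _ _ _ S_points _ _ x])
  show "\<not> contained_in_divisor X S" using not_div by (simp add: S_def)
  show "opn (frame x) \<and> x \<in> frame x" if "x \<in> points X" for x
    using that opn_frame in_frame by blast
  show "(triv H x z $ 1 $ 1)\<^sup>2 \<noteq> 0" if "x \<in> points X" "z \<in> frame x" for x z
    using that line_coords_nonzero[OF that(1)] by (simp add: frame_def)
  show "det (twisted_endo (\<phi> z)) = 0" if "z \<in> S" for z
  proof -
    have z: "z \<in> points X" using that S_points by blast
    show ?thesis
      using det_endo_zero_at_S[OF \<phi> that] det_endo_loc[OF z in_frame[OF z], of \<phi>]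
        line_coords_nonzero(3)[OF z charts(11)[OF z]] by simp
  qed
next
  fix x assume x: "x \<in> points X"
  note V = opn_frame[OF x]
  have "(\<lambda>z. det (endo_loc \<phi> x z)) \<in> hol X (frame x)"
    using endo_loc_hol[OF \<phi> x] unfolding det_2 hol_mat_def
    by (intro hol_diff[OF V] hol_mult[OF V]) auto
  then show "(\<lambda>z. (triv H x z $ 1 $ 1)\<^sup>2 * det (twisted_endo (\<phi> z))) \<in> hol X (frame x)"
    by (rule hol_cong[OF V]) (simp add: det_endo_loc[OF x])
next
  fix x y assume x: "x \<in> points X" and y: "y \<in> points X"
  have V: "opn (frame x \<inter> frame y)" using opn_frame x y by blast
  have "(\<lambda>z. ratio H x y z * ratio H x y z) \<in> hol X (frame x \<inter> frame y)"
    by (intro hol_mult[OF V] ratio_hol[OF x y V]) (auto simp: frame_def)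
  then show "(\<lambda>z. (triv H x z $ 1 $ 1)\<^sup>2 / (triv H y z $ 1 $ 1)\<^sup>2) \<in> hol X (frame x \<inter> frame y)"
    by (rule hol_cong[OF V]) (simp add: power2_eq_square)
qed

lemma endo_nilpotent:
  assumes "\<phi> \<in> H0_End0 X E H"
  shows "nilpotent_section X \<phi>"
  unfolding nilpotent_section_def
proof (intro exI[of _ 2] ballI)
  fix z assume z: "z \<in> points X"
  have "trace (twisted_endo (\<phi> z)) = 0" using H0_End0D(3)[OF assms] z by blast
  from trace_free_singular_square[OF this det_endo_zero[OF assms z]]
  show "((\<lambda>B. twisted_endo (\<phi> z) ** B) ^^ 2) (mat 1) = 0" by (simp add: numeral_2_eq_2)
qed

end

section \<open>Sections of rank one\<close>

lemma index_1_1_1: "k = ((1, 1), 1)" for k :: "(1 \<times> 1) \<times> 1"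
  by (simp add: prod_eq_iff)

lemma twisted_endo_inj: "twisted_endo v = twisted_endo w \<Longrightarrow> v = w"
proof -
  assume eq: "twisted_endo v = twisted_endo w"
  have "v $ k = w $ k" for k
  proof -
    have "k = ((fst (fst k), snd (fst k)), 1)" by (simp add: prod_eq_iff)
    moreover have "v $ ((i, j), 1) = w $ ((i, j), 1)" for i j
      using arg_cong[OF eq, of "\<lambda>M. M $ i $ j"] by (simp add: twisted_endo_def)
    ultimately show ?thesis by metis
  qed
  then show ?thesis by (simp add: vec_eq_iff)
qed

section \<open>Sections of the line bundle built from \<open>L1\<close>, \<open>L2\<close> and
  \<open>H\<close>\<close>

context serre_extension
begin

abbreviation HomH :: "('a, (1 \<times> 1) \<times> 1) vbundle" where
  "HomH \<equiv> tensor (tensor L1 (dual L2)) H"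

abbreviation coord :: "complex^((1 \<times> 1) \<times> 1) \<Rightarrow> complex" where
  "coord v \<equiv> v $ ((1, 1), 1)"

definition hom_frame :: "'a \<Rightarrow> 'a \<Rightarrow> complex" where
  "hom_frame x z = triv L1 x z $ 1 $ 1 * matrix_inv (triv L2 x z) $ 1 $ 1 * triv H x z $ 1 $ 1"

lemma triv_Hom: "(triv HomH x z *v v) $ k = hom_frame x z * coord v"
proof -
  have "triv HomH x z $ ((1, 1), 1) $ ((1, 1), 1) = hom_frame x z"
    by (simp add: tensor_def dual_def transpose_def hom_frame_def)
  then have "(triv HomH x z *v v) $ ((1, 1), 1) = hom_frame x z * coord v"
    unfolding matrix_vector_mult_def vec_lambda_beta sum_UNIV_prod sum_1 by simp
  then show ?thesis using index_1_1_1[of k] by simp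
qed

lemma H0_Hom_iff:
  "\<psi> \<in> H0 X HomH \<longleftrightarrow> (\<forall>z. z \<notin> points X \<longrightarrow> \<psi> z = 0) \<and>
     (\<forall>x\<in>points X. (\<lambda>z. hom_frame x z * coord (\<psi> z)) \<in> hol X (points X \<inter> (chart L1 x \<inter> chart L2 x \<inter> chart H x)))"
proof -
  have "chart HomH x = chart L1 x \<inter> chart L2 x \<inter> chart H x" for x
    by (simp add: tensor_def dual_def)
  moreover have "(\<forall>k::(1 \<times> 1) \<times> 1. Q) \<longleftrightarrow> Q" for Q by blast
  ultimately show ?thesis
    unfolding H0_def sections_def triv_Hom mem_Collect_eq by simp
qed

lemma opn_chart_Hom: "x \<in> points X \<Longrightarrow> opn (chart L1 x \<inter> chart L2 x \<inter> chart H x)"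
  by (intro openin_Int charts)

lemma hom_frame_eq:
  assumes "x \<in> points X" "z \<in> chart L2 x"
  shows "hom_frame x z = triv L1 x z $ 1 $ 1 * triv H x z $ 1 $ 1 / triv L2 x z $ 1 $ 1"
  by (simp add: hom_frame_def invertible_1_1(2)[OF chartD(3)[OF L2 assms]] divide_inverse)

lemma hom_frame_nonzero:
  assumes "x \<in> points X" "z \<in> frame x"
  shows "hom_frame x z \<noteq> 0"
  using assms hom_frame_eq line_coords_nonzero[OF assms(1)] by (simp add: frame_def)

lemma Hom_loc_hol:
  assumes "\<psi> \<in> H0 X HomH" "x \<in> points X"
  shows "(\<lambda>z. hom_frame x z * coord (\<psi> z)) \<in> hol X (frame x)"
proof (rule hol_subset[OF opn_chart_Hom[OF assms(2)] _ opn_frame[OF assms(2)]])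
  show "(\<lambda>z. hom_frame x z * coord (\<psi> z)) \<in> hol X (chart L1 x \<inter> chart L2 x \<inter> chart H x)"
    using H0_Hom_iff[THEN iffD1, THEN conjunct2, OF assms(1), THEN bspec, OF assms(2)]
    unfolding points_Int[OF opn_chart_Hom[OF assms(2)]] .
qed (auto simp: frame_def)

text \<open>Each point may use its own frame and an arbitrarily small neighbourhood, which suits
  sections whose values on \<open>S\<close> come from local extensions. The ratios of frames carry
  the result to all charts.\<close>

lemma H0_HomI:
  assumes out: "\<And>z. z \<notin> points X \<Longrightarrow> \<psi> z = 0"
    and hol: "\<And>y. y \<in> points X \<Longrightarrow> \<exists>V. opn V \<and> y \<in> V \<and> V \<subseteq> frame y \<and> (\<lambda>z. hom_frame y z * coord (\<psi> z)) \<in> hol X V"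
  shows "\<psi> \<in> H0 X HomH"
  unfolding H0_Hom_iff
proof (intro conjI allI impI ballI out)
  fix x assume x: "x \<in> points X"
  let ?W = "chart L1 x \<inter> chart L2 x \<inter> chart H x"
  have W: "opn ?W" by (rule opn_chart_Hom[OF x])
  have "(\<lambda>z. hom_frame x z * coord (\<psi> z)) \<in> hol X ?W"
  proof (rule hol_local[OF W])
    fix y assume "y \<in> ?W"
    then have y: "y \<in> points X" by (rule opn_points[OF W])
    obtain V where V: "opn V" "y \<in> V" "V \<subseteq> frame y" and hV: "(\<lambda>z. hom_frame y z * coord (\<psi> z)) \<in> hol X V"
      using hol[OF y] by blast
    have U: "opn (?W \<inter> V)" by (rule openin_Int[OF W V(1)])
    have "(\<lambda>z. ratio L1 x y z * ratio L2 y x z * ratio H x y z * (hom_frame y z * coord (\<psi> z))) \<in> hol X (?W \<inter> V)"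
      by (intro hol_mult[OF U] ratio_hol[OF x y U] ratio_hol[OF y x U] hol_subset[OF V(1) hV U])
        (use V(3) in \<open>auto simp: frame_def\<close>)
    then have "(\<lambda>z. hom_frame x z * coord (\<psi> z)) \<in> hol X (?W \<inter> V)"
    proof (rule hol_cong[OF U])
      fix z assume z: "z \<in> ?W \<inter> V"
      then have "z \<in> frame y" using V(3) by blast
      then show "ratio L1 x y z * ratio L2 y x z * ratio H x y z * (hom_frame y z * coord (\<psi> z)) =
          hom_frame x z * coord (\<psi> z)"
        using z hom_frame_eq[OF x, of z] hom_frame_eq[OF y, of z] line_coords_nonzero[OF y, of z]
        by (simp add: frame_def)
    qed
    then show "\<exists>V. opn V \<and> y \<in> V \<and> (\<lambda>z. hom_frame x z * coord (\<psi> z)) \<in> hol X (?W \<inter> V)"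
      using V(1,2) by blast
  qed
  then show "(\<lambda>z. hom_frame x z * coord (\<psi> z)) \<in> hol X (points X \<inter> ?W)"
    unfolding points_Int[OF W] .
qed

section \<open>The map sending \<open>\<psi>\<close> to \<open>\<iota> \<psi> p\<close>, and its
  inverse\<close>

text \<open>The composite \<open>\<iota> \<psi> p\<close>, with \<open>\<psi>\<close> read as a
  morphism from \<open>L2\<close> to \<open>L1\<close> twisted by \<open>H\<close>. The index
  \<open>k\<close> has the form \<open>((i, j), 1)\<close>.\<close>

definition rank_one :: "('a \<Rightarrow> complex^((1 \<times> 1) \<times> 1)) \<Rightarrow> 'a \<Rightarrow> complex^((2 \<times> 2) \<times> 1)" where
  "rank_one \<psi> z = (\<chi> k. \<iota> z $ fst (fst k) $ 1 * coord (\<psi> z) * p z $ 1 $ snd (fst k))"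

lemma twisted_endo_rank_one: "twisted_endo (rank_one \<psi> z) $ i $ j = \<iota> z $ i $ 1 * coord (\<psi> z) * p z $ 1 $ j"
  by (simp add: twisted_endo_def rank_one_def)

text \<open>The frame factors by which \<open>\<iota>_loc\<close> and \<open>p_loc\<close> differ
  from \<open>\<iota>\<close> and \<open>p\<close> combine with that of \<open>H\<close> into
  \<open>hom_frame\<close>, so the coefficient is exactly the local coordinate of
  \<open>\<psi>\<close>.\<close>

lemma endo_loc_rank_one:
  assumes x: "x \<in> points X" "z \<in> frame x"
  shows "endo_loc (rank_one \<psi>) x z $ i $ j =
    hom_frame x z * coord (\<psi> z) * \<iota>_loc x z $ i $ 1 * p_loc x z $ 1 $ j"
proof -
  note inv = invertible_frame[OF x]
  let ?A = "triv E x z" and ?F = "twisted_endo (rank_one \<psi> z)"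
  have "?A ** \<iota> z = \<iota>_loc x z ** triv L1 x z"
    by (simp only: \<iota>_loc_def matrix_inv_cancel_mult(2)[OF inv(2)])
  then have l: "(?A ** \<iota> z) $ i $ 1 = \<iota>_loc x z $ i $ 1 * triv L1 x z $ 1 $ 1"
    by (simp add: matrix_matrix_mult_def sum_1)
  have "p z ** matrix_inv ?A = matrix_inv (triv L2 x z) ** p_loc x z"
    by (simp only: p_loc_def matrix_mul_assoc[symmetric] matrix_inv_cancel_mult(4)[OF inv(3)])
  then have r: "(p z ** matrix_inv ?A) $ 1 $ j = matrix_inv (triv L2 x z) $ 1 $ 1 * p_loc x z $ 1 $ j"
    by (simp add: matrix_matrix_mult_def sum_1)
  have "(?A ** ?F ** matrix_inv ?A) $ i $ j = (?A ** \<iota> z) $ i $ 1 * coord (\<psi> z) * (p z ** matrix_inv ?A) $ 1 $ j"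
    unfolding matrix_matrix_mult_def vec_lambda_beta sum_2 twisted_endo_rank_one by algebra
  then show ?thesis
    by (simp add: endo_loc_def hom_frame_def l r)
qed

lemma rank_one_End0:
  assumes \<psi>: "\<psi> \<in> H0 X HomH"
  shows "rank_one \<psi> \<in> H0_End0 X E H"
proof (rule H0_End0I)
  show "rank_one \<psi> z = 0" if "z \<notin> points X" for z
    using H0_Hom_iff[THEN iffD1, THEN conjunct1, OF \<psi>] that by (simp add: rank_one_def vec_eq_iff)
  show "trace (twisted_endo (rank_one \<psi> z)) = 0" if "z \<in> points X" for z
  proof -
    \<comment> \<open>Cyclicity of the trace turns \<open>\<iota> \<psi> p\<close> into
      \<open>\<psi> p \<iota>\<close>.\<close>
    have "trace (twisted_endo (rank_one \<psi> z)) = coord (\<psi> z) * (p z ** \<iota> z) $ 1 $ 1"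
      unfolding trace_def sum_2 twisted_endo_rank_one matrix_matrix_mult_def vec_lambda_beta by algebra
    then show ?thesis using p_\<iota>[OF that] by simp
  qed
  fix x assume x: "x \<in> points X"
  show "hol_mat (frame x) (endo_loc (rank_one \<psi>) x)"
    unfolding hol_mat_def
  proof (intro allI)
    fix i j
    have "(\<lambda>z. hom_frame x z * coord (\<psi> z) * \<iota>_loc x z $ i $ 1 * p_loc x z $ 1 $ j) \<in> hol X (frame x)"
      using \<iota>_loc_hol[OF x] p_loc_hol[OF x] unfolding hol_mat_def
      by (intro hol_mult[OF opn_frame[OF x]] Hom_loc_hol[OF \<psi> x]) blast+
    then show "(\<lambda>z. endo_loc (rank_one \<psi>) x z $ i $ j) \<in> hol X (frame x)"
      by (rule hol_cong[OF opn_frame[OF x]]) (simp add: endo_loc_rank_one[OF x])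
  qed
qed

lemma coord_ext: "coord v = coord w \<Longrightarrow> v = w"
  unfolding vec_eq_iff using index_1_1_1 by metis

lemma rank_one_cancel:
  assumes z: "z \<in> points X" "z \<notin> S" and eq: "rank_one \<psi> z = rank_one \<psi>' z"
  shows "\<psi> z = \<psi>' z"
proof -
  obtain i where i: "\<iota> z $ i $ 1 \<noteq> 0" using \<iota>_nonzero[OF z] by (auto simp: vec_eq_iff)
  obtain j where j: "p z $ 1 $ j \<noteq> 0" using p_nonzero[OF z] by (auto simp: vec_eq_iff)
  have "\<iota> z $ i $ 1 * coord (\<psi> z) * p z $ 1 $ j = \<iota> z $ i $ 1 * coord (\<psi>' z) * p z $ 1 $ j"
    using eq twisted_endo_rank_one by metis
  then show ?thesis using i j by (intro coord_ext) simp
qed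

lemma isolating_frame:
  assumes x: "x \<in> points X"
  obtains V where "opn V" "x \<in> V" "V \<subseteq> frame x" "V \<inter> S \<subseteq> {x}"
proof (cases "x \<in> S")
  case True
  show thesis
    by (rule isolating[OF True opn_frame[OF x] in_frame[OF x]]) (rule that, auto)
next
  case False
  then show thesis
    using opn_minus_S[OF opn_frame[OF x]] in_frame[OF x] by (intro that[of "frame x - S"]) auto
qed

text \<open>Off \<open>S\<close> both \<open>\<iota>\<close> and \<open>p\<close> are nonzero and
  \<open>\<psi>\<close> can be read off. On \<open>S\<close> the formula loses all information
  because \<open>p\<close> vanishes, and holomorphy of the local coordinate decides.\<close>

lemma inj_rank_one: "inj_on rank_one (H0 X HomH)"
proof (rule inj_onI, rule ext)
  fix \<psi> \<psi>' x
  assume \<psi>: "\<psi> \<in> H0 X HomH" and \<psi>': "\<psi>' \<in> H0 X HomH" and eq: "rank_one \<psi> = rank_one \<psi>'"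
  have off: "\<psi> z = \<psi>' z" if "z \<in> points X" "z \<notin> S" for z
    using rank_one_cancel[OF that] eq by simp
  show "\<psi> x = \<psi>' x"
  proof (cases "x \<in> points X")
    case False
    then show ?thesis
      using H0_Hom_iff[THEN iffD1, THEN conjunct1, OF \<psi>] H0_Hom_iff[THEN iffD1, THEN conjunct1, OF \<psi>'] by simp
  next
    case x: True
    obtain V where V: "opn V" "x \<in> V" "V \<subseteq> frame x" "V \<inter> S \<subseteq> {x}"
      by (rule isolating_frame[OF x])
    have "hom_frame x x * coord (\<psi> x) - hom_frame x x * coord (\<psi>' x) = 0"
    proof (rule hol_eq_zero_at[OF V(1,2), of "\<lambda>z. hom_frame x z * coord (\<psi> z) - hom_frame x z * coord (\<psi>' z)"])
      show "(\<lambda>z. hom_frame x z * coord (\<psi> z) - hom_frame x z * coord (\<psi>' z)) \<in> hol X V"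
        by (intro hol_diff[OF V(1)] hol_subset[OF opn_frame[OF x] _ V(1,3)] Hom_loc_hol[OF \<psi> x] Hom_loc_hol[OF \<psi>' x])
      show "hom_frame x z * coord (\<psi> z) - hom_frame x z * coord (\<psi>' z) = 0" if "z \<in> V" "z \<noteq> x" for z
      proof -
        have "z \<notin> S" using that V(4) by blast
        then show ?thesis using off opn_points[OF V(1) that(1)] by simp
      qed
    qed
    then show ?thesis using hom_frame_nonzero[OF x in_frame[OF x]] by (intro coord_ext) simp
  qed
qed

text \<open>Only the value at \<open>z\<close> matters, so a constant function serves as a
  placeholder for the section still to be found.\<close>

lemma endo_eq_rank_one:
  assumes \<phi>: "\<phi> \<in> H0_End0 X E H" and z: "z \<in> points X" "z \<notin> S"
  shows "\<exists>t. \<phi> z = rank_one (\<lambda>_. \<chi> k. t) z"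
proof -
  have "trace (twisted_endo (\<phi> z)) = 0" using H0_End0D(3)[OF \<phi>] z(1) by blast
  from nilpotent_rank_one[OF p_nonzero[OF z] \<iota>_nonzero[OF z] p_\<iota>[OF z(1)] p_endo_\<iota>[OF \<phi> z(1)] this det_endo_zero[OF \<phi> z(1)]]
  obtain t where t: "\<forall>k j. twisted_endo (\<phi> z) $ k $ j = \<iota> z $ k $ 1 * t * p z $ 1 $ j" by blast
  have "twisted_endo (\<phi> z) = twisted_endo (rank_one (\<lambda>_. \<chi> k. t) z)"
    unfolding vec_eq_iff twisted_endo_rank_one using t by simp
  then show ?thesis using twisted_endo_inj by blast
qed

text \<open>Near a point off \<open>S\<close> some entry of \<open>\<iota>_loc\<close> and some
  entry of \<open>p_loc\<close> have no zeros; the coordinate of \<open>\<psi>\<close> is the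
  matching entry of \<open>\<phi>\<close> divided by their product.\<close>

lemma rank_one_coeff_hol:
  assumes \<phi>: "\<phi> \<in> H0_End0 X E H" and x: "x \<in> points X"
    and \<psi>: "\<And>z. z \<in> points X \<Longrightarrow> z \<notin> S \<Longrightarrow> \<phi> z = rank_one \<psi> z"
  shows "(\<lambda>z. hom_frame x z * coord (\<psi> z)) \<in> hol X (frame x - S)"
proof (rule hol_local[OF opn_minus_S[OF opn_frame[OF x]]])
  fix y assume y: "y \<in> frame x - S"
  have W: "opn (frame x - S)" by (rule opn_minus_S[OF opn_frame[OF x]])
  have yp: "y \<in> points X" by (rule opn_points[OF W y])
  have ne: "\<iota>_loc x y \<noteq> 0" "p_loc x y \<noteq> 0"
    using \<iota>_loc_eq_0[OF x] p_loc_eq_0[OF x] \<iota>_nonzero[OF yp] p_nonzero[OF yp] y by auto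
  obtain i where i: "\<iota>_loc x y $ i $ 1 \<noteq> 0" using ne(1) by (auto simp: vec_eq_iff)
  obtain j where j: "p_loc x y $ 1 $ j \<noteq> 0" using ne(2) by (auto simp: vec_eq_iff)
  have hol: "(\<lambda>z. endo_loc \<phi> x z $ i $ j) \<in> hol X (frame x)" "(\<lambda>z. \<iota>_loc x z $ i $ 1) \<in> hol X (frame x)"
    "(\<lambda>z. p_loc x z $ 1 $ j) \<in> hol X (frame x)"
    using endo_loc_hol[OF \<phi> x] \<iota>_loc_hol[OF x] p_loc_hol[OF x] unfolding hol_mat_def by blast+
  note hol_m = hol_mult[OF opn_frame[OF x] hol(2,3)]
  define V where "V = {z \<in> frame x. \<iota>_loc x z $ i $ 1 * p_loc x z $ 1 $ j \<noteq> 0}"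
  have V: "opn V" unfolding V_def by (rule opn_nonzero[OF opn_frame[OF x] hol_m])
  have yV: "y \<in> V" using y i j by (simp add: V_def)
  let ?U = "(frame x - S) \<inter> V"
  have U: "opn ?U" by (rule openin_Int[OF W V])
  have sub: "?U \<subseteq> frame x" by blast
  have "(\<lambda>z. endo_loc \<phi> x z $ i $ j / (\<iota>_loc x z $ i $ 1 * p_loc x z $ 1 $ j)) \<in> hol X ?U"
    by (intro hol_divide[OF U] hol_subset[OF opn_frame[OF x] _ U sub] hol(1) hol_m) (simp add: V_def)
  then have "(\<lambda>z. hom_frame x z * coord (\<psi> z)) \<in> hol X ?U"
  proof (rule hol_cong[OF U])
    fix z assume z: "z \<in> ?U"
    have zp: "z \<in> points X" by (rule opn_points[OF U z])
    have "endo_loc \<phi> x z = endo_loc (rank_one \<psi>) x z"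
      using \<psi>[OF zp] z by (simp add: endo_loc_def)
    then have "endo_loc \<phi> x z $ i $ j = hom_frame x z * coord (\<psi> z) * (\<iota>_loc x z $ i $ 1 * p_loc x z $ 1 $ j)"
      using endo_loc_rank_one[OF x, of z \<psi> i j] z by simp
    then show "endo_loc \<phi> x z $ i $ j / (\<iota>_loc x z $ i $ 1 * p_loc x z $ 1 $ j) = hom_frame x z * coord (\<psi> z)"
      using z by (simp add: V_def)
  qed
  then show "\<exists>V. opn V \<and> y \<in> V \<and> (\<lambda>z. hom_frame x z * coord (\<psi> z)) \<in> hol X ((frame x - S) \<inter> V)"
    using V yV by blast
qed

lemma endo_loc_cancel:
  assumes x: "x \<in> points X" "z \<in> frame x" and eq: "endo_loc \<phi> x z = endo_loc \<phi>' x z"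
  shows "\<phi> z = \<phi>' z"
proof (rule twisted_endo_inj)
  note inv = invertible_frame(1)[OF x]
  have h: "triv H x z $ 1 $ 1 \<noteq> 0" using line_coords_nonzero(3)[OF x(1)] x(2) by (auto simp: frame_def)
  let ?A = "triv E x z"
  have "(?A ** twisted_endo (\<phi> z) ** matrix_inv ?A) $ i $ j = (?A ** twisted_endo (\<phi>' z) ** matrix_inv ?A) $ i $ j" for i j
    using arg_cong[OF eq, of "\<lambda>M. M $ i $ j"] h by (simp add: endo_loc_def)
  then have "?A ** twisted_endo (\<phi> z) ** matrix_inv ?A = ?A ** twisted_endo (\<phi>' z) ** matrix_inv ?A"
    by (simp add: vec_eq_iff)
  from arg_cong[OF this, of "\<lambda>M. matrix_inv ?A ** (M ** ?A)"]
  show "twisted_endo (\<phi> z) = twisted_endo (\<phi>' z)"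
    by (simp only: matrix_mul_assoc[symmetric] matrix_inv_cancel_mult(4)[OF inv] matrix_inv_cancel(2)[OF inv] matrix_mul_rid)
qed

lemma rank_one_surj:
  assumes \<phi>: "\<phi> \<in> H0_End0 X E H"
  obtains \<psi> where "\<psi> \<in> H0 X HomH" "rank_one \<psi> = \<phi>"
proof -
  have "\<forall>z. \<exists>t. z \<in> points X \<longrightarrow> z \<notin> S \<longrightarrow> \<phi> z = rank_one (\<lambda>_. \<chi> k. t) z"
    using endo_eq_rank_one[OF \<phi>] by blast
  then obtain t where t: "\<forall>z. z \<in> points X \<longrightarrow> z \<notin> S \<longrightarrow> \<phi> z = rank_one (\<lambda>_. \<chi> k. t z) z"
    using choice by metis
  \<comment> \<open>What extends across \<open>x\<close> is the coordinate in the frame at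
    \<open>x\<close>, not the possibly discontinuous \<open>t\<close>.\<close>
  have ext: "\<exists>V d. opn V \<and> x \<in> V \<and> V \<subseteq> frame x \<and> V \<inter> S = {x} \<and> (\<lambda>z. hom_frame x z * t z)(x := d) \<in> hol X V"
    if xS: "x \<in> S" for x
  proof -
    have x: "x \<in> points X" using xS S_points by blast
    obtain V where V: "opn V" "x \<in> V" "V \<subseteq> frame x" "V \<inter> S = {x}"
      by (rule isolating[OF xS opn_frame[OF x] in_frame[OF x]])
    have Vx: "V - {x} = V - S" using V by blast
    have op: "opn (V - {x})" unfolding Vx by (rule opn_minus_S[OF V(1)])
    have "(\<lambda>z. hom_frame x z * coord (\<chi> k. t z)) \<in> hol X (frame x - S)"
      by (rule rank_one_coeff_hol[OF \<phi> x, of "\<lambda>z. \<chi> k. t z"]) (use t in \<open>simp add: rank_one_def\<close>)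
    then have "(\<lambda>z. hom_frame x z * t z) \<in> hol X (V - {x})"
      using hol_subset[OF opn_minus_S[OF opn_frame[OF x]] _ op] V(3) Vx by auto
    from hartogs_quotient[OF V(1,2) op this] V show ?thesis by metis
  qed
  then obtain d where d: "\<And>x. x \<in> S \<Longrightarrow> \<exists>V. opn V \<and> x \<in> V \<and> V \<subseteq> frame x \<and> V \<inter> S = {x} \<and>
      (\<lambda>z. hom_frame x z * t z)(x := d x) \<in> hol X V"
    by metis
  \<comment> \<open>On \<open>S\<close> the extended coordinate \<open>d z\<close> is converted back
    to a fibre value by dividing by the frame at \<open>z\<close>. Outside the space the value is 0,
    as for every section.\<close>
  define \<psi> :: "'a \<Rightarrow> complex^((1 \<times> 1) \<times> 1)" where
    "\<psi> = (\<lambda>z. if z \<notin> points X then 0 else \<chi> k. if z \<in> S then d z / hom_frame z z else t z)"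
  have \<psi>_off: "\<phi> z = rank_one \<psi> z" if "z \<in> points X" "z \<notin> S" for z
    using t that by (simp add: \<psi>_def rank_one_def)
  have \<psi>: "\<psi> \<in> H0 X HomH"
  proof (rule H0_HomI)
    show "\<psi> z = 0" if "z \<notin> points X" for z using that by (simp add: \<psi>_def)
    fix y assume y: "y \<in> points X"
    show "\<exists>V. opn V \<and> y \<in> V \<and> V \<subseteq> frame y \<and> (\<lambda>z. hom_frame y z * coord (\<psi> z)) \<in> hol X V"
    proof (cases "y \<in> S")
      case False
      then show ?thesis
        using rank_one_coeff_hol[OF \<phi> y \<psi>_off] opn_minus_S[OF opn_frame[OF y]] in_frame[OF y]
        by (intro exI[of _ "frame y - S"]) auto
    next
      case True
      then obtain V where V: "opn V" "y \<in> V" "V \<subseteq> frame y" "V \<inter> S = {y}"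
        and hV: "(\<lambda>z. hom_frame y z * t z)(y := d y) \<in> hol X V" using d by blast
      have "(\<lambda>z. hom_frame y z * coord (\<psi> z)) \<in> hol X V"
      proof (rule hol_cong[OF V(1) hV])
        fix z assume z: "z \<in> V"
        have "z \<in> points X" by (rule opn_points[OF V(1) z])
        moreover have "z \<in> S \<longleftrightarrow> z = y" using V(4) z by blast
        ultimately show "((\<lambda>z. hom_frame y z * t z)(y := d y)) z = hom_frame y z * coord (\<psi> z)"
          using hom_frame_nonzero[OF y in_frame[OF y]] by (auto simp: \<psi>_def)
      qed
      with V show ?thesis by blast
    qed
  qed
  have "rank_one \<psi> x = \<phi> x" for x
  proof (cases "x \<in> points X")
    case False
    then show ?thesis
      using H0_End0D(1)[OF \<phi>] H0_End0D(1)[OF rank_one_End0[OF \<psi>]] by simp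
  next
    case x: True
    obtain V where V: "opn V" "x \<in> V" "V \<subseteq> frame x" "V \<inter> S \<subseteq> {x}"
      by (rule isolating_frame[OF x])
    \<comment> \<open>Agreement at points of \<open>S\<close> was not built into
      \<open>\<psi>\<close>. It follows because both sides are holomorphic in the frame at
      \<open>x\<close> and agree off \<open>x\<close>.\<close>
    have "endo_loc (rank_one \<psi>) x x $ i $ j - endo_loc \<phi> x x $ i $ j = 0" for i j
    proof (rule hol_eq_zero_at[OF V(1,2), of "\<lambda>z. endo_loc (rank_one \<psi>) x z $ i $ j - endo_loc \<phi> x z $ i $ j"])
      show "(\<lambda>z. endo_loc (rank_one \<psi>) x z $ i $ j - endo_loc \<phi> x z $ i $ j) \<in> hol X V"
        using endo_loc_hol[OF \<phi> x] endo_loc_hol[OF rank_one_End0[OF \<psi>] x] unfolding hol_mat_def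
        by (intro hol_diff[OF V(1)] hol_subset[OF opn_frame[OF x] _ V(1,3)]) blast+
      show "endo_loc (rank_one \<psi>) x z $ i $ j - endo_loc \<phi> x z $ i $ j = 0" if "z \<in> V" "z \<noteq> x" for z
      proof -
        have "z \<notin> S" using that V(4) by blast
        then show ?thesis using \<psi>_off opn_points[OF V(1) that(1)] by (simp add: endo_loc_def)
      qed
    qed
    then show ?thesis
      by (intro endo_loc_cancel[OF x in_frame[OF x]]) (simp add: vec_eq_iff)
  qed
  then show thesis using that[OF \<psi>] by blast
qed

lemma H0_Hom_linear:
  assumes "\<psi> \<in> H0 X HomH"
  shows "\<psi>' \<in> H0 X HomH \<Longrightarrow> (\<lambda>z. \<psi> z + \<psi>' z) \<in> H0 X HomH"
    and "(\<lambda>z. c *s \<psi> z) \<in> H0 X HomH"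
proof -
  note out = H0_Hom_iff[THEN iffD1, THEN conjunct1]
  show "(\<lambda>z. \<psi> z + \<psi>' z) \<in> H0 X HomH" if \<psi>': "\<psi>' \<in> H0 X HomH"
  proof (rule H0_HomI)
    fix y assume y: "y \<in> points X"
    note V = opn_frame[OF y]
    have "(\<lambda>z. hom_frame y z * coord (\<psi> z) + hom_frame y z * coord (\<psi>' z)) \<in> hol X (frame y)"
      by (intro hol_add[OF V] Hom_loc_hol assms \<psi>' y)
    then have "(\<lambda>z. hom_frame y z * coord (\<psi> z + \<psi>' z)) \<in> hol X (frame y)"
      by (simp add: distrib_left)
    then show "\<exists>V. opn V \<and> y \<in> V \<and> V \<subseteq> frame y \<and> (\<lambda>z. hom_frame y z * coord (\<psi> z + \<psi>' z)) \<in> hol X V"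
      using V in_frame[OF y] by blast
  qed (use out[OF assms] out[OF \<psi>'] in simp)
  show "(\<lambda>z. c *s \<psi> z) \<in> H0 X HomH"
  proof (rule H0_HomI)
    fix y assume y: "y \<in> points X"
    note V = opn_frame[OF y]
    have "(\<lambda>z. c * (hom_frame y z * coord (\<psi> z))) \<in> hol X (frame y)"
      by (intro hol_mult[OF V] hol_const[OF V] Hom_loc_hol assms y)
    then have "(\<lambda>z. hom_frame y z * coord (c *s \<psi> z)) \<in> hol X (frame y)"
      by (simp add: mult.left_commute)
    then show "\<exists>V. opn V \<and> y \<in> V \<and> V \<subseteq> frame y \<and> (\<lambda>z. hom_frame y z * coord (c *s \<psi> z)) \<in> hol X V"
      using V in_frame[OF y] by blast
  qed (use out[OF assms] in simp)
qed

lemma End0_isomorphic_Hom: "linear_isomorphic (H0_End0 X E H) (H0 X HomH)"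
proof (rule linear_isomorphic_inverse[where R = rank_one])
  show "bij_betw rank_one (H0 X HomH) (H0_End0 X E H)"
    unfolding bij_betw_def
  proof (intro conjI inj_rank_one equalityI subsetI)
    fix \<phi> assume "\<phi> \<in> H0_End0 X E H"
    then obtain \<psi> where "\<psi> \<in> H0 X HomH" "rank_one \<psi> = \<phi>" by (rule rank_one_surj)
    then show "\<phi> \<in> rank_one ` H0 X HomH" by blast
  qed (use rank_one_End0 in blast)
  show "rank_one (\<lambda>z. s z + t z) = (\<lambda>z. rank_one s z + rank_one t z)" for s t
    by (simp add: fun_eq_iff vec_eq_iff rank_one_def algebra_simps)
  show "rank_one (\<lambda>z. c *s s z) = (\<lambda>z. c *s rank_one s z)" for c s
    by (simp add: fun_eq_iff vec_eq_iff rank_one_def)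
qed (fact H0_Hom_linear)+

end

lemma Div_group_line_bundle: "Div_group X L \<Longrightarrow> line_bundle X L"
  by (induction rule: Div_group.induct)

theorem proposition6p1:
  fixes X :: "'a cspace"
    and E :: "('a, 2) vbundle"
    and L1 L2 H :: "('a, 1) vbundle"
    and \<iota> :: "'a \<Rightarrow> complex^1^2"
    and p :: "'a \<Rightarrow> complex^2^1"
    and I\<^sub>Z :: "'a set \<Rightarrow> ('a \<Rightarrow> complex) set"
  assumes "hopf_surface X"
    and "vector_bundle X E" and "filtrable X E"
    and "line_bundle X L1" and "line_bundle X L2"
    and "zero_dimensional_subspace X I\<^sub>Z"
    and "serre_sequence X L1 \<iota> E p L2 I\<^sub>Z"
    and "\<not> contained_in_divisor X (subspace_support X I\<^sub>Z)"
    and "Div_group X H"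
  shows "linear_isomorphic (H0_End0 X E H) (H0 X (tensor (tensor L1 (dual L2)) H)) \<and>
         (\<forall>\<phi>\<in>H0_End0 X E H. nilpotent_section X \<phi>)"
proof -
  obtain a b \<mu> r q where "0 < cmod a \<and> cmod a \<le> cmod b \<and> cmod b < 1 \<and> 0 < r \<and> (a - b ^ r) * \<mu> = 0 \<and>
      quotient_map (top_of_set (- {0})) (top_of X) q \<and>
      (\<forall>z\<in>- {0}. \<forall>w\<in>- {0}. q z = q w \<longleftrightarrow>
         (\<exists>n. (hopf_map a b \<mu> r ^^ n) z = w \<or> (hopf_map a b \<mu> r ^^ n) w = z)) \<and>
      (\<forall>U. openin (top_of X) U \<longrightarrow>
         hol X U = {f. holomorphic2_on (f \<circ> q) {z \<in> - {0}. q z \<in> U}})"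
    using assms(1) unfolding hopf_surface_def by (elim exE)
  then interpret hopf_quotient X a b \<mu> r q
    by unfold_locales auto
  interpret serre_extension X a b \<mu> r q E L1 L2 H \<iota> p I\<^sub>Z
    using assms Div_group_line_bundle by unfold_locales
  show ?thesis using End0_isomorphic_Hom endo_nilpotent by blast
qed

end
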